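(* Let $\mathbf n=(n_1,\dots,n_k)\in\mathbb N^k$. The set of all $k$-multi-Toeplitz operators on $\bigotimes_{i=1}^kF^2(H_{n_i})$ coincides with $$\operatorname{span}\{\boldsymbol{\mathcal A}_{\mathbf n}^*\boldsymbol{\mathcal A}_{\mathbf n}\}^{-\mathrm{SOT}}=\operatorname{span}\{\boldsymbol{\mathcal A}_{\mathbf n}^*\boldsymbol{\mathcal A}_{\mathbf n}\}^{-\mathrm{WOT}},$$ where $\boldsymbol{\mathcal A}_{\mathbf n}$ is the polyball algebra.
   Context: Here $\mathbb N=\{1,2,\dots\}$. For $i=1,\dots,k$ let $H_{n_i}$ be an $n_i$-dimensional complex Hilbert space with orthonormal basis $e^i_1,\dots,e^i_{n_i}$, $F^2(H_{n_i})=\mathbb C1\oplus\bigoplus_{p\ge1}H_{n_i}^{\otimes p}$ its full Fock space, and $\mathbb F_{n_i}^+$ the unital free semigroup with generators $g^i_1,\dots,g^i_{n_i}$ and identity $g^i_0$. For $\alpha=g^i_{j_1}\cdots g^i_{j_p}$ put $e^i_\alpha=e^i_{j_1}\otimes\cdots\otimes e^i_{j_p}$, and $e^i_{g^i_0}=1$. The left and right creation operators on $F^2(H_{n_i})$ are $S_{i,j}e^i_\alpha=e^i_{g^i_j\alpha}$ and $R_{i,j}e^i_\alpha=e^i_{\alpha g^i_j}$; $\mathbf S_{i,j}$ and $\mathbf R_{i,j}$ are their ampliations to $\bigotimes_{i=1}^kF^2(H_{n_i})$ (acting on the $i$-th factor, identity on the others). The polyball algebra $\boldsymbol{\mathcal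 A}_{\mathbf n}$ is the norm closed non-selfadjoint algebra generated by all $\mathbf S_{i,j}$ and the identity, and $\operatorname{span}\{\boldsymbol{\mathcal A}_{\mathbf n}^*\boldsymbol{\mathcal A}_{\mathbf n}\}$ is the linear span of all $f^*g$ with $f,g\in\boldsymbol{\mathcal A}_{\mathbf n}$. A bounded operator $T$ on $\bigotimes_{i=1}^kF^2(H_{n_i})$ is $k$-multi-Toeplitz if $\mathbf R_{i,s}^*T\mathbf R_{i,t}=\delta_{st}T$ for all $i\in\{1,\dots,k\}$ and $s,t\in\{1,\dots,n_i\}$. The superscripts $-\mathrm{SOT}$, $-\mathrm{WOT}$ denote closure in the strong, respectively weak, operator topology. *)

theory Defs
  imports "HOL-Analysis.Analysis" "HOL-Library.Function_Algebras"
begin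

section \<open>The Hilbert space of square summable families\<close>

text \<open>
  The Hilbert space with orthonormal basis indexed by a set \<^term>\<open>I\<close> is realised as the carrier set
  of all square summable complex families which vanish outside \<^term>\<open>I\<close>.  A carrier set is used
  instead of a type because the index sets below depend on the numbers $n_1, \ldots, n_k$.
\<close>

definition l2 :: "'i set \<Rightarrow> ('i \<Rightarrow> complex) set" where
  "l2 I = {x. (\<forall>\<alpha>. \<alpha> \<notin> I \<longrightarrow> x \<alpha> = 0) \<and> (\<lambda>\<alpha>. (cmod (x \<alpha>))\<^sup>2) summable_on I}"

definition l2_inner :: "('i \<Rightarrow> complex) \<Rightarrow> ('i \<Rightarrow> complex) \<Rightarrow> complex" where
  "l2_inner x y = (\<Sum>\<^sub>\<infinity>\<alpha>. x \<alpha> * cnj (y \<alpha>))"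

definition l2_norm :: "('i \<Rightarrow> complex) \<Rightarrow> real" where
  "l2_norm x = sqrt (\<Sum>\<^sub>\<infinity>\<alpha>. (cmod (x \<alpha>))\<^sup>2)"

definition ket :: "'i \<Rightarrow> 'i \<Rightarrow> complex" where
  "ket \<alpha> = (\<lambda>\<beta>. if \<beta> = \<alpha> then 1 else 0)"

definition l2_topology :: "'i set \<Rightarrow> ('i \<Rightarrow> complex) topology" where
  "l2_topology I = Metric_space.mtopology (l2 I) (\<lambda>x y. l2_norm (x - y))"

section \<open>Bounded operators\<close>

type_synonym 'i l2_op = "('i \<Rightarrow> complex) \<Rightarrow> ('i \<Rightarrow> complex)"

text \<open>
  Operators are normalised to be \<open>0\<close> outside the carrier.  Hence equality of operators is equality
  of functions, and sums and compositions of operators are those of functions.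
\<close>

definition bop :: "'i set \<Rightarrow> 'i l2_op set" where
  "bop I = {T. (\<forall>x\<in>l2 I. T x \<in> l2 I) \<and>
               (\<forall>x. x \<notin> l2 I \<longrightarrow> T x = 0) \<and>
               (\<forall>x\<in>l2 I. \<forall>y\<in>l2 I. T (x + y) = T x + T y) \<and>
               (\<forall>c. \<forall>x\<in>l2 I. T (\<lambda>\<alpha>. c * x \<alpha>) = (\<lambda>\<alpha>. c * T x \<alpha>)) \<and>
               (\<exists>B. \<forall>x\<in>l2 I. l2_norm (T x) \<le> B * l2_norm x)}"

definition id_op :: "'i set \<Rightarrow> 'i l2_op" where
  "id_op I = (\<lambda>x. if x \<in> l2 I then x else 0)"

definition scale_op :: "complex \<Rightarrow> 'i l2_op \<Rightarrow> 'i l2_op" where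
  "scale_op c T = (\<lambda>x \<alpha>. c * T x \<alpha>)"

global_interpretation l2_op: vector_space scale_op
  by unfold_locales (auto simp: scale_op_def fun_eq_iff algebra_simps)

definition adj_op :: "'i set \<Rightarrow> 'i l2_op \<Rightarrow> 'i l2_op" where
  "adj_op I T = (THE U. U \<in> bop I \<and> (\<forall>x\<in>l2 I. \<forall>y\<in>l2 I. l2_inner (T x) y = l2_inner x (U y)))"

text \<open>
  The value \<open>0\<close> for unbounded \<^term>\<open>T\<close> is never relevant below, but makes \<open>op_norm I (S - T)\<close>
  nonnegative for arbitrary arguments, as the locale \<^locale>\<open>Metric_space\<close> demands.
\<close>

definition op_norm :: "'i set \<Rightarrow> 'i l2_op \<Rightarrow> real" where
  "op_norm I T = (if T \<in> bop I then (SUP x\<in>{x \<in> l2 I. l2_norm x \<le> 1}. l2_norm (T x)) else 0)"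

definition norm_op_topology :: "'i set \<Rightarrow> 'i l2_op topology" where
  "norm_op_topology I = Metric_space.mtopology (bop I) (\<lambda>S T. op_norm I (S - T))"

text \<open>
  The strong (weak) operator topology is the coarsest topology on \<^term>\<open>bop I\<close> for which all the maps
  \<open>T \<mapsto> T x\<close> (all the maps \<open>T \<mapsto> l2_inner (T x) y\<close>) are continuous.
\<close>

definition sot :: "'i set \<Rightarrow> 'i l2_op topology" where
  "sot I = pullback_topology (bop I) (\<lambda>T. \<lambda>x\<in>l2 I. T x)
             (product_topology (\<lambda>_. l2_topology I) (l2 I))"

definition wot :: "'i set \<Rightarrow> 'i l2_op topology" where
  "wot I = pullback_topology (bop I) (\<lambda>T. \<lambda>(x, y)\<in>l2 I \<times> l2 I. l2_inner (T x) y)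
             (product_topology (\<lambda>_. euclidean) (l2 I \<times> l2 I))"

definition norm_closed_algebra :: "'i set \<Rightarrow> 'i l2_op set \<Rightarrow> bool" where
  "norm_closed_algebra I A \<longleftrightarrow>
     A \<subseteq> bop I \<and> l2_op.subspace A \<and> (\<forall>S\<in>A. \<forall>T\<in>A. S \<circ> T \<in> A) \<and> closedin (norm_op_topology I) A"

section \<open>Full Fock spaces and their tensor product\<close>

text \<open>
  The free semigroup on $n$ generators is the set of words over $\{1,\ldots,n\}$ with concatenation,
  its identity being the empty word.  Since the words of length $p$ index the orthonormal basis
  $e_{j_1} \otimes \cdots \otimes e_{j_p}$ of $H_n^{\otimes p}$, the full Fock space $F^2(H_n)$ is
  \<open>l2 (words n)\<close>, with $e_\alpha$ being \<open>ket \<alpha>\<close>.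
\<close>

definition words :: "nat \<Rightarrow> nat list set" where
  "words n = lists {1..n}"

definition left_creation :: "nat \<Rightarrow> nat \<Rightarrow> nat list l2_op" where
  "left_creation n j x =
     (if x \<in> l2 (words n) then (\<lambda>\<beta>. if \<beta> \<noteq> [] \<and> hd \<beta> = j then x (tl \<beta>) else 0) else 0)"

definition right_creation :: "nat \<Rightarrow> nat \<Rightarrow> nat list l2_op" where
  "right_creation n j x =
     (if x \<in> l2 (words n) then (\<lambda>\<beta>. if \<beta> \<noteq> [] \<and> last \<beta> = j then x (butlast \<beta>) else 0) else 0)"

text \<open>
  The Hilbert space tensor product of the spaces \<open>l2 (words (n i))\<close>, $1 \le i \le k$, is
  \<open>l2 (multi_words k n)\<close>; the elementary tensors are given by \<open>tensor k n\<close>.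
\<close>

definition multi_words :: "nat \<Rightarrow> (nat \<Rightarrow> nat) \<Rightarrow> (nat \<Rightarrow> nat list) set" where
  "multi_words k n = (\<Pi>\<^sub>E i\<in>{1..k}. words (n i))"

definition tensor ::
  "nat \<Rightarrow> (nat \<Rightarrow> nat) \<Rightarrow> (nat \<Rightarrow> nat list \<Rightarrow> complex) \<Rightarrow> (nat \<Rightarrow> nat list) \<Rightarrow> complex" where
  "tensor k n x = (\<lambda>\<alpha>. if \<alpha> \<in> multi_words k n then \<Prod>i=1..k. x i (\<alpha> i) else 0)"

text \<open>
  The ampliation $I \otimes \cdots \otimes A \otimes \cdots \otimes I$ of an operator $A$ on the $i$-th
  factor applies $A$ to the slices of a vector in the direction of the $i$-th coordinate.
\<close>

definition ampliation ::
  "nat \<Rightarrow> (nat \<Rightarrow> nat) \<Rightarrow> nat \<Rightarrow> nat list l2_op \<Rightarrow> (nat \<Rightarrow> nat list) l2_op" where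
  "ampliation k n i A x =
     (if x \<in> l2 (multi_words k n)
      then (\<lambda>\<alpha>. if \<alpha> \<in> multi_words k n then A (\<lambda>\<beta>. x (\<alpha>(i := \<beta>))) (\<alpha> i) else 0)
      else 0)"

definition S_op :: "nat \<Rightarrow> (nat \<Rightarrow> nat) \<Rightarrow> nat \<Rightarrow> nat \<Rightarrow> (nat \<Rightarrow> nat list) l2_op" where
  "S_op k n i j = ampliation k n i (left_creation (n i) j)"

definition R_op :: "nat \<Rightarrow> (nat \<Rightarrow> nat) \<Rightarrow> nat \<Rightarrow> nat \<Rightarrow> (nat \<Rightarrow> nat list) l2_op" where
  "R_op k n i j = ampliation k n i (right_creation (n i) j)"

lemma ket_in_l2: "\<alpha> \<in> I \<Longrightarrow> ket \<alpha> \<in> l2 I"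
proof -
  assume "\<alpha> \<in> I"
  moreover have "(\<lambda>\<beta>. (cmod (ket \<alpha> \<beta>))\<^sup>2) summable_on I"
    by (rule summable_on_cong_neutral[where S = "{\<alpha>} \<inter> I", THEN iffD1])
       (auto simp: ket_def)
  ultimately show ?thesis by (auto simp: l2_def ket_def)
qed

lemma left_creation_ket:
  "\<alpha> \<in> words n \<Longrightarrow> left_creation n j (ket \<alpha>) = ket (j # \<alpha>)"
  by (rule ext) (auto simp: left_creation_def ket_in_l2, auto simp: ket_def neq_Nil_conv)

lemma right_creation_ket:
  assumes "\<alpha> \<in> words n"
  shows "right_creation n j (ket \<alpha>) = ket (\<alpha> @ [j])"
proof -
  have "\<beta> \<noteq> [] \<and> last \<beta> = j \<and> butlast \<beta> = \<alpha> \<longleftrightarrow> \<beta> = \<alpha> @ [j]" for \<beta> :: "nat list"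
    by (cases \<beta> rule: rev_cases) auto
  then show ?thesis
    using ket_in_l2[OF assms] by (auto simp: right_creation_def fun_eq_iff ket_def)
qed

lemma tensor_in_l2:
  assumes "\<And>i. i \<in> {1..k} \<Longrightarrow> x i \<in> l2 (words (n i))"
  shows "tensor k n x \<in> l2 (multi_words k n)"
proof -
  let ?P = "multi_words k n" and ?f = "\<lambda>i \<beta>. (cmod (x i \<beta>))\<^sup>2"
  have "(\<lambda>\<alpha>. \<Prod>i=1..k. ?f i (\<alpha> i)) summable_on ?P"
  proof (rule nonneg_bdd_above_summable_on)
    show "bdd_above (sum (\<lambda>\<alpha>. \<Prod>i=1..k. ?f i (\<alpha> i)) ` {F. F \<subseteq> ?P \<and> finite F})"
    proof (rule bdd_aboveI2)
      fix F assume "F \<in> {F. F \<subseteq> ?P \<and> finite F}"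
      then have F: "F \<subseteq> ?P" "finite F" by auto
      define G where "G i = (\<lambda>\<alpha>. \<alpha> i) ` F" for i
      have fin: "finite (G i)" for i using F by (simp add: G_def)
      have G: "G i \<subseteq> words (n i)" if "i \<in> {1..k}" for i
        using F that by (auto simp: G_def multi_words_def PiE_def Pi_def)
      have "F \<subseteq> (\<Pi>\<^sub>E i\<in>{1..k}. G i)"
        using F by (auto simp: G_def multi_words_def PiE_def)
      then have "(\<Sum>\<alpha>\<in>F. \<Prod>i=1..k. ?f i (\<alpha> i)) \<le> (\<Sum>\<alpha>\<in>(\<Pi>\<^sub>E i\<in>{1..k}. G i). \<Prod>i=1..k. ?f i (\<alpha> i))"
        by (intro sum_mono2 finite_PiE) (auto simp: fin intro!: prod_nonneg)
      also have "\<dots> = (\<Prod>i=1..k. \<Sum>\<beta>\<in>G i. ?f i \<beta>)"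
        by (rule prod_sum_PiE[symmetric]) (auto simp: fin)
      also have "\<dots> \<le> (\<Prod>i=1..k. \<Sum>\<^sub>\<infinity>\<beta>\<in>words (n i). ?f i \<beta>)"
        using assms G fin
        by (intro prod_mono conjI finite_sum_le_infsum sum_nonneg) (auto simp: l2_def)
      finally show "(\<Sum>\<alpha>\<in>F. \<Prod>i=1..k. ?f i (\<alpha> i))
                      \<le> (\<Prod>i=1..k. \<Sum>\<^sub>\<infinity>\<beta>\<in>words (n i). ?f i \<beta>)" .
    qed
  qed (auto intro!: prod_nonneg)
  then have "(\<lambda>\<alpha>. (cmod (tensor k n x \<alpha>))\<^sup>2) summable_on ?P"
    by (rule summable_on_cong[THEN iffD1, rotated])
       (auto simp: tensor_def prod_norm[symmetric] prod_power_distrib)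
  then show ?thesis by (auto simp: l2_def tensor_def)
qed

lemma ampliation_tensor:
  assumes x: "\<And>i. i \<in> {1..k} \<Longrightarrow> x i \<in> l2 (words (n i))"
    and i: "i \<in> {1..k}" and A: "A \<in> bop (words (n i))"
  shows "ampliation k n i A (tensor k n x) = tensor k n (x(i := A (x i)))"
proof
  fix \<alpha>
  show "ampliation k n i A (tensor k n x) \<alpha> = tensor k n (x(i := A (x i))) \<alpha>"
  proof (cases "\<alpha> \<in> multi_words k n")
    case True
    define c where "c = (\<Prod>l\<in>{1..k} - {i}. x l (\<alpha> l))"
    have "tensor k n x (\<alpha>(i := \<beta>)) = c * x i \<beta>" for \<beta>
    proof (cases "\<beta> \<in> words (n i)")
      case b: True
      have "\<alpha>(i := \<beta>) \<in> multi_words k n"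
        using True i b by (auto simp: multi_words_def PiE_def Pi_def extensional_def)
      moreover have "(\<Prod>l=1..k. x l ((\<alpha>(i := \<beta>)) l)) = c * x i \<beta>"
        using i by (subst prod.remove[of _ i]) (auto simp: c_def intro!: prod.cong)
      ultimately show ?thesis by (simp add: tensor_def)
    next
      case b: False
      then have "\<alpha>(i := \<beta>) \<notin> multi_words k n"
        using i by (auto simp: multi_words_def PiE_def Pi_def)
      moreover have "x i \<beta> = 0" using x[OF i] b by (auto simp: l2_def)
      ultimately show ?thesis by (simp add: tensor_def)
    qed
    then have "ampliation k n i A (tensor k n x) \<alpha> = A (\<lambda>\<beta>. c * x i \<beta>) (\<alpha> i)"
      using tensor_in_l2[of k x n] x True by (simp add: ampliation_def)
    also have "\<dots> = c * A (x i) (\<alpha> i)"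
      using A x[OF i] by (auto simp: bop_def)
    also have "\<dots> = tensor k n (x(i := A (x i))) \<alpha>"
      using True i unfolding tensor_def
      by (subst prod.remove[of _ i]) (auto simp: c_def intro!: prod.cong)
    finally show ?thesis .
  qed (use tensor_in_l2[of k x n] x in \<open>auto simp: ampliation_def tensor_def\<close>)
qed

section \<open>The polyball algebra and multi-Toeplitz operators\<close>

definition polyball_algebra :: "nat \<Rightarrow> (nat \<Rightarrow> nat) \<Rightarrow> (nat \<Rightarrow> nat list) l2_op set" where
  "polyball_algebra k n =
     norm_closed_algebra (multi_words k n) hull
       (insert (id_op (multi_words k n)) {S_op k n i j | i j. i \<in> {1..k} \<and> j \<in> {1..n i}})"

definition span_star_product :: "nat \<Rightarrow> (nat \<Rightarrow> nat) \<Rightarrow> (nat \<Rightarrow> nat list) l2_op set" where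
  "span_star_product k n =
     l2_op.span {adj_op (multi_words k n) f \<circ> g | f g.
                   f \<in> polyball_algebra k n \<and> g \<in> polyball_algebra k n}"

definition multi_Toeplitz :: "nat \<Rightarrow> (nat \<Rightarrow> nat) \<Rightarrow> (nat \<Rightarrow> nat list) l2_op \<Rightarrow> bool" where
  "multi_Toeplitz k n T \<longleftrightarrow>
     T \<in> bop (multi_words k n) \<and>
     (\<forall>i\<in>{1..k}. \<forall>s\<in>{1..n i}. \<forall>t\<in>{1..n i}.
        adj_op (multi_words k n) (R_op k n i s) \<circ> T \<circ> R_op k n i t = (if s = t then T else 0))"

end

theory Submission
  imports Defs
begin

text \<open>
  The operators in question form a set closed in the weak operator topology which contains
  all products \<open>f\<^sup>* g\<close>, because the polyball algebra commutes with the isometries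
  $\mathbf R_{i,t}$, whose ranges are orthogonal for different \<open>t\<close>.  Conversely, in the matrix of a
  multi-Toeplitz operator \<open>T\<close> an entry depends only on what remains of the two indexing
  multi-words after removing common suffixes; hence every multi-homogeneous component of \<open>T\<close> is a
  finite combination of operators $\mathbf S_\delta^* \mathbf S_\gamma$.  The Fejer means of \<open>T\<close>
  are finite sums of such components.  They are averages of compressions of \<open>T\<close> to windows of
  degrees, so that they are bounded by \<open>\<parallel>T\<parallel>\<close>, and therefore they converge strongly to \<open>T\<close>.
\<close>

section \<open>Square summable families\<close>

text \<open>Partial sums of the expansion into multi-homogeneous components need not be uniformly
  bounded, and without a uniform bound convergence on basis vectors does not pass to all vectors;
  hence the Fejer weights. A common way to bound Fejer means is to integrate over a torus of gauge
  automorphisms. Here the kernel is instead a count of common points of two boxes in the lattice of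
  degrees, so that finite sums and the Cauchy-Schwarz inequality suffice.

  The polyball algebra is a hull, that is, an intersection of norm closed algebras. A property of
  its elements is therefore proved by exhibiting one norm closed algebra that contains the
  generators and has the property; the commutant of the right creation operators serves this
  purpose.

  Removing common suffixes leaves an empty word on at least one side in each coordinate. This
  normalisation makes the product of shifts that produces a given matrix entry unique. Each mean is
  a finite sum because the alphabets are finite and the kernel of order \<open>N\<close> vanishes
  once the lengths differ by \<open>N\<close> or more in some coordinate.\<close>

lemma l2_iff:
  "x \<in> l2 I \<longleftrightarrow> (\<forall>\<alpha>. \<alpha> \<notin> I \<longrightarrow> x \<alpha> = 0) \<and> (\<lambda>\<alpha>. (cmod (x \<alpha>))\<^sup>2) summable_on UNIV"
proof -
  have "(\<lambda>\<alpha>. (cmod (x \<alpha>))\<^sup>2) summable_on I \<longleftrightarrow> (\<lambda>\<alpha>. (cmod (x \<alpha>))\<^sup>2) summable_on UNIV"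
    if "\<forall>\<alpha>. \<alpha> \<notin> I \<longrightarrow> x \<alpha> = 0"
    by (rule summable_on_cong_neutral) (use that in auto)
  then show ?thesis by (auto simp: l2_def)
qed

lemma l2_outside: "x \<in> l2 I \<Longrightarrow> \<alpha> \<notin> I \<Longrightarrow> x \<alpha> = 0"
  by (simp add: l2_def)

lemma l2_summable: "x \<in> l2 I \<Longrightarrow> (\<lambda>\<alpha>. (cmod (x \<alpha>))\<^sup>2) summable_on UNIV"
  by (simp add: l2_iff)

lemma l2_norm_nonneg [simp]: "0 \<le> l2_norm x"
  by (simp add: l2_norm_def infsum_nonneg)

lemma l2_norm_minus_commute: "l2_norm (x - y) = l2_norm (y - x)"
  by (simp add: l2_norm_def norm_minus_commute)

lemma L2_set_le_l2_norm:
  assumes "x \<in> l2 I" "finite F"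
  shows "L2_set (\<lambda>\<alpha>. cmod (x \<alpha>)) F \<le> l2_norm x"
  unfolding L2_set_def l2_norm_def
  by (intro real_sqrt_le_mono finite_sum_le_infsum l2_summable[OF assms(1)] assms(2)) auto

lemma norm_le_l2_norm: "x \<in> l2 I \<Longrightarrow> cmod (x \<alpha>) \<le> l2_norm x"
  using L2_set_le_l2_norm[of x I "{\<alpha>}"] by simp

text \<open>A sum of nonnegative terms is the supremum of its finite partial sums. This reduces norm
  estimates, such as the triangle inequality, to estimates for \<open>L2_set\<close> on finite
  sets.\<close>

lemma
  assumes outside: "\<And>\<alpha>. \<alpha> \<notin> I \<Longrightarrow> x \<alpha> = 0"
    and bound: "\<And>F. finite F \<Longrightarrow> L2_set (\<lambda>\<alpha>. cmod (x \<alpha>)) F \<le> C"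
  shows l2_memI: "x \<in> l2 I" and l2_norm_leI: "l2_norm x \<le> C"
proof -
  have C: "0 \<le> C" using bound[of "{}"] by simp
  have le: "(\<Sum>\<alpha>\<in>F. (cmod (x \<alpha>))\<^sup>2) \<le> C\<^sup>2" if "finite F" for F
    using bound[OF that] C by (simp add: L2_set_def sqrt_le_D)
  have summable: "(\<lambda>\<alpha>. (cmod (x \<alpha>))\<^sup>2) summable_on UNIV"
    by (rule nonneg_bdd_above_summable_on) (auto intro!: bdd_aboveI2[where M = "C\<^sup>2"] le)
  then show "x \<in> l2 I" using outside by (simp add: l2_iff)
  have "(\<Sum>\<^sub>\<infinity>\<alpha>. (cmod (x \<alpha>))\<^sup>2) \<le> C\<^sup>2"
    using le by (intro infsum_le_finite_sums summable) auto
  then show "l2_norm x \<le> C"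
    unfolding l2_norm_def using C real_le_lsqrt by blast
qed

lemma l2_zero [simp]: "0 \<in> l2 I"
  by (simp add: l2_def)

lemma l2_norm_zero [simp]: "l2_norm 0 = 0"
  by (simp add: l2_norm_def)

lemma l2_norm_eq_0: "x \<in> l2 I \<Longrightarrow> l2_norm x = 0 \<longleftrightarrow> x = 0"
  using norm_le_l2_norm[of x I] by (auto simp: fun_eq_iff l2_norm_def)

lemma
  assumes x: "x \<in> l2 I" and y: "y \<in> l2 I"
  shows l2_add: "x + y \<in> l2 I" and l2_norm_triangle: "l2_norm (x + y) \<le> l2_norm x + l2_norm y"
proof -
  have le: "L2_set (\<lambda>\<alpha>. cmod ((x + y) \<alpha>)) F \<le> l2_norm x + l2_norm y" if "finite F" for F
  proof -
    have "L2_set (\<lambda>\<alpha>. cmod ((x + y) \<alpha>)) F \<le> L2_set (\<lambda>\<alpha>. cmod (x \<alpha>) + cmod (y \<alpha>)) F"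
      by (rule L2_set_mono) (auto simp: norm_triangle_ineq)
    also have "\<dots> \<le> L2_set (\<lambda>\<alpha>. cmod (x \<alpha>)) F + L2_set (\<lambda>\<alpha>. cmod (y \<alpha>)) F"
      by (rule L2_set_triangle_ineq)
    also have "\<dots> \<le> l2_norm x + l2_norm y"
      by (intro add_mono L2_set_le_l2_norm[OF x that] L2_set_le_l2_norm[OF y that])
    finally show ?thesis .
  qed
  have outside: "(x + y) \<alpha> = 0" if "\<alpha> \<notin> I" for \<alpha>
    using that l2_outside[OF x] l2_outside[OF y] by simp
  from outside le show "x + y \<in> l2 I" by (rule l2_memI)
  from outside le show "l2_norm (x + y) \<le> l2_norm x + l2_norm y" by (rule l2_norm_leI)
qed

lemma l2_norm_scale: "l2_norm (\<lambda>\<alpha>. c * x \<alpha>) = cmod c * l2_norm x"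
  by (simp add: l2_norm_def norm_mult power_mult_distrib infsum_cmult_right' real_sqrt_mult)

lemma l2_scale: "x \<in> l2 I \<Longrightarrow> (\<lambda>\<alpha>. c * x \<alpha>) \<in> l2 I"
  by (auto simp: l2_iff norm_mult power_mult_distrib summable_on_cmult_right)

lemma l2_diff: "x \<in> l2 I \<Longrightarrow> y \<in> l2 I \<Longrightarrow> x - y \<in> l2 I"
  using l2_add[of x I "\<lambda>\<alpha>. (-1) * y \<alpha>"] l2_scale[of y I "-1"]
  by (simp add: plus_fun_def fun_diff_def)

lemma Metric_space_l2: "Metric_space (l2 I) (\<lambda>x y. l2_norm (x - y))"
proof
  fix x y z assume "x \<in> l2 I" "y \<in> l2 I" "z \<in> l2 I"
  then show "l2_norm (x - z) \<le> l2_norm (x - y) + l2_norm (y - z)"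
    using l2_norm_triangle[of "x - y" I "y - z"] by (simp add: l2_diff)
qed (auto simp: l2_norm_minus_commute l2_norm_eq_0[OF l2_diff])

interpretation l2: Metric_space "l2 I" "\<lambda>x y. l2_norm (x - y)" for I
  by (rule Metric_space_l2)

lemma topspace_l2_topology [simp]: "topspace (l2_topology I) = l2 I"
  by (simp add: l2_topology_def)

text \<open>One bound on finite partial sums gives both claims. Absolute summability is recorded
  separately because the infinite sums are additive only for summable families.\<close>

lemma
  assumes x: "x \<in> l2 I" and y: "y \<in> l2 I"
  shows l2_inner_abs_summable: "(\<lambda>\<alpha>. norm (x \<alpha> * cnj (y \<alpha>))) summable_on UNIV"
    and l2_Cauchy_Schwarz: "cmod (l2_inner x y) \<le> l2_norm x * l2_norm y"
proof -
  have le: "(\<Sum>\<alpha>\<in>F. norm (x \<alpha> * cnj (y \<alpha>))) \<le> l2_norm x * l2_norm y" if "finite F" for F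
  proof -
    have "(\<Sum>\<alpha>\<in>F. norm (x \<alpha> * cnj (y \<alpha>)))
        \<le> L2_set (\<lambda>\<alpha>. cmod (x \<alpha>)) F * L2_set (\<lambda>\<alpha>. cmod (y \<alpha>)) F"
      using L2_set_mult_ineq[of "\<lambda>\<alpha>. cmod (x \<alpha>)" "\<lambda>\<alpha>. cmod (y \<alpha>)" F] by (simp add: norm_mult)
    also have "\<dots> \<le> l2_norm x * l2_norm y"
      by (intro mult_mono L2_set_le_l2_norm[OF x that] L2_set_le_l2_norm[OF y that]) auto
    finally show ?thesis .
  qed
  show summable: "(\<lambda>\<alpha>. norm (x \<alpha> * cnj (y \<alpha>))) summable_on UNIV"
    by (rule nonneg_bdd_above_summable_on)
       (auto intro!: bdd_aboveI2[where M = "l2_norm x * l2_norm y"] le)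
  have "cmod (l2_inner x y) \<le> (\<Sum>\<^sub>\<infinity>\<alpha>. norm (x \<alpha> * cnj (y \<alpha>)))"
    unfolding l2_inner_def by (rule norm_infsum_bound[OF summable])
  also have "\<dots> \<le> l2_norm x * l2_norm y"
    by (rule infsum_le_finite_sums[OF summable]) (rule le)
  finally show "cmod (l2_inner x y) \<le> l2_norm x * l2_norm y" .
qed

lemma l2_inner_summable:
  "x \<in> l2 I \<Longrightarrow> y \<in> l2 I \<Longrightarrow> (\<lambda>\<alpha>. x \<alpha> * cnj (y \<alpha>)) summable_on UNIV"
  by (rule Infinite_Sum.abs_summable_summable, rule l2_inner_abs_summable)

lemma l2_inner_commute: "l2_inner y x = cnj (l2_inner x y)"
  by (simp add: l2_inner_def infsum_cnj[symmetric] mult.commute)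

lemma l2_inner_add_left:
  "x \<in> l2 I \<Longrightarrow> y \<in> l2 I \<Longrightarrow> z \<in> l2 I \<Longrightarrow> l2_inner (x + y) z = l2_inner x z + l2_inner y z"
  by (simp add: l2_inner_def distrib_right infsum_add l2_inner_summable)

lemma l2_inner_add_right:
  "x \<in> l2 I \<Longrightarrow> y \<in> l2 I \<Longrightarrow> z \<in> l2 I \<Longrightarrow> l2_inner x (y + z) = l2_inner x y + l2_inner x z"
  by (simp add: l2_inner_def distrib_left infsum_add l2_inner_summable)

lemma l2_inner_scale_left: "l2_inner (\<lambda>\<alpha>. c * x \<alpha>) y = c * l2_inner x y"
  by (simp add: l2_inner_def mult.assoc infsum_cmult_right')

lemma l2_inner_scale_right: "l2_inner x (\<lambda>\<alpha>. c * y \<alpha>) = cnj c * l2_inner x y"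
  by (simp add: l2_inner_def mult.left_commute[of _ "cnj c"] infsum_cmult_right')

lemma l2_inner_diff_left:
  "x \<in> l2 I \<Longrightarrow> y \<in> l2 I \<Longrightarrow> z \<in> l2 I \<Longrightarrow> l2_inner (x - y) z = l2_inner x z - l2_inner y z"
  using l2_inner_add_left[of "x - y" I y z] by (simp add: l2_diff)

lemma l2_inner_zero [simp]: "l2_inner 0 y = 0" "l2_inner x 0 = 0"
  by (simp_all add: l2_inner_def)

lemma l2_inner_ket_right [simp]: "l2_inner x (ket \<alpha>) = x \<alpha>"
proof -
  have "(\<Sum>\<^sub>\<infinity>\<beta>. x \<beta> * cnj (ket \<alpha> \<beta>)) = (\<Sum>\<^sub>\<infinity>\<beta>\<in>{\<alpha>}. x \<beta>)"
    by (rule infsum_cong_neutral) (auto simp: ket_def)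
  then show ?thesis by (simp add: l2_inner_def)
qed

lemma l2_inner_ket_left [simp]: "l2_inner (ket \<alpha>) x = cnj (x \<alpha>)"
  by (subst l2_inner_commute) simp

section \<open>Finite truncations and density\<close>

definition truncation :: "'i set \<Rightarrow> ('i \<Rightarrow> complex) \<Rightarrow> 'i \<Rightarrow> complex" where
  "truncation F x = (\<lambda>\<alpha>. if \<alpha> \<in> F then x \<alpha> else 0)"

lemma truncation_insert:
  "\<alpha> \<notin> F \<Longrightarrow> truncation (insert \<alpha> F) x = truncation F x + (\<lambda>\<beta>. x \<alpha> * ket \<alpha> \<beta>)"
  by (auto simp: truncation_def ket_def fun_eq_iff)

text \<open>The family \<open>x\<close> is arbitrary here. This matters where a truncated family is
  not yet known to be square summable, as for the candidate adjoint in
  \<open>adjoint_exists\<close>.\<close>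

lemma
  assumes F: "finite F" "F \<subseteq> I"
  shows truncation_in_l2: "truncation F x \<in> l2 I"
    and l2_norm_truncation: "l2_norm (truncation F x) = L2_set (\<lambda>\<alpha>. cmod (x \<alpha>)) F"
proof -
  have "(\<lambda>\<alpha>. (cmod (truncation F x \<alpha>))\<^sup>2) summable_on UNIV
      \<longleftrightarrow> (\<lambda>\<alpha>. (cmod (truncation F x \<alpha>))\<^sup>2) summable_on F"
    by (rule summable_on_cong_neutral) (auto simp: truncation_def)
  then show "truncation F x \<in> l2 I" using F by (auto simp: l2_iff truncation_def)
  have "(\<Sum>\<^sub>\<infinity>\<alpha>. (cmod (truncation F x \<alpha>))\<^sup>2) = (\<Sum>\<^sub>\<infinity>\<alpha>\<in>F. (cmod (x \<alpha>))\<^sup>2)"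
    by (rule infsum_cong_neutral) (auto simp: truncation_def)
  then show "l2_norm (truncation F x) = L2_set (\<lambda>\<alpha>. cmod (x \<alpha>)) F"
    using F by (simp add: l2_norm_def L2_set_def)
qed

lemma l2_truncation_approx:
  assumes x: "x \<in> l2 I" and e: "0 < e"
  obtains F where "finite F" "F \<subseteq> I" "l2_norm (x - truncation F x) \<le> e"
proof -
  define f where "f = (\<lambda>\<alpha>. (cmod (x \<alpha>))\<^sup>2)"
  have summable: "f summable_on I" using x by (simp add: l2_def f_def)
  have "(sum f \<longlongrightarrow> infsum f I) (finite_subsets_at_top I)"
    using summable by (rule infsum_tendsto)
  then have "\<forall>\<^sub>F F in finite_subsets_at_top I. dist (sum f F) (infsum f I) < e\<^sup>2"
    using e by (intro tendstoD) auto
  then obtain F where F: "finite F" "F \<subseteq> I" "dist (sum f F) (infsum f I) < e\<^sup>2"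
    unfolding eventually_finite_subsets_at_top by blast
  have "L2_set (\<lambda>\<alpha>. cmod ((x - truncation F x) \<alpha>)) G \<le> e" if G: "finite G" for G
  proof -
    \<comment> \<open>The mass of \<open>x\<close> that the truncation misses within
      \<open>G\<close> is part of the tail of the convergent sum beyond \<open>F\<close>.\<close>
    have "(\<Sum>\<alpha>\<in>G. (cmod ((x - truncation F x) \<alpha>))\<^sup>2) = sum f (G \<inter> I - F)"
      using G l2_outside[OF x]
      by (intro sum.mono_neutral_cong_right) (auto simp: f_def truncation_def)
    also have "\<dots> = sum f (G \<inter> I \<union> F) - sum f F"
      using sum_diff[of "G \<inter> I \<union> F" F f] F G by (simp add: Un_Diff)
    also have "\<dots> \<le> infsum f I - sum f F"
      using F G by (intro diff_right_mono finite_sum_le_infsum summable) (auto simp: f_def)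
    finally show ?thesis
      unfolding L2_set_def using F e by (intro real_le_lsqrt) (auto simp: dist_real_def)
  qed
  then have "l2_norm (x - truncation F x) \<le> e"
    by (intro l2_norm_leI[where I = I]) (auto simp: truncation_def l2_outside[OF x])
  with F show ?thesis using that by blast
qed

text \<open>The density of the finitely supported families, in the form in which it is always applied.\<close>

lemma l2_functional_eq_0:
  fixes \<phi> :: "('i \<Rightarrow> complex) \<Rightarrow> complex"
  assumes add: "\<And>x y. x \<in> l2 I \<Longrightarrow> y \<in> l2 I \<Longrightarrow> \<phi> (x + y) = \<phi> x + \<phi> y"
    and scale: "\<And>c x. x \<in> l2 I \<Longrightarrow> \<phi> (\<lambda>\<alpha>. c * x \<alpha>) = c * \<phi> x"
    and bound: "\<And>x. x \<in> l2 I \<Longrightarrow> cmod (\<phi> x) \<le> B * l2_norm x"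
    and ket: "\<And>\<alpha>. \<alpha> \<in> I \<Longrightarrow> \<phi> (ket \<alpha>) = 0"
    and x: "x \<in> l2 I"
  shows "\<phi> x = 0"
proof -
  have zero: "\<phi> 0 = 0" using bound[of 0] by simp
  have trunc: "\<phi> (truncation F x) = 0" if "finite F" "F \<subseteq> I" for F
    using that
  proof (induction F)
    case empty
    then show ?case using zero by (simp add: truncation_def zero_fun_def)
  next
    case (insert \<alpha> F)
    then have "\<phi> (truncation (insert \<alpha> F) x) = \<phi> (truncation F x) + x \<alpha> * \<phi> (ket \<alpha>)"
      by (simp only: truncation_insert add scale truncation_in_l2 l2_scale ket_in_l2
            insert_subset simp_thms)
    then show ?case using insert by (simp add: ket)
  qed
  have "cmod (\<phi> x) \<le> e" if e: "0 < e" for e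
  proof -
    \<comment> \<open>The constant \<open>B\<close> may be zero or negative, so
      \<open>\<bar>B\<bar> + 1\<close> is used as a positive divisor. The same guard
      \<open>+ 1\<close> recurs in later estimates.\<close>
    obtain F where F: "finite F" "F \<subseteq> I" "l2_norm (x - truncation F x) \<le> e / (\<bar>B\<bar> + 1)"
      using e by (rule_tac l2_truncation_approx[OF x, of "e / (\<bar>B\<bar> + 1)"]) auto
    have d: "x - truncation F x \<in> l2 I"
      using F x by (intro l2_diff truncation_in_l2)
    have "\<phi> x = \<phi> (x - truncation F x)"
      using add[OF d truncation_in_l2[of F I x]] F trunc by simp
    then have "cmod (\<phi> x) \<le> B * l2_norm (x - truncation F x)"
      using bound[OF d] by simp
    also have "\<dots> \<le> (\<bar>B\<bar> + 1) * l2_norm (x - truncation F x)"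
      by (rule mult_right_mono) auto
    also have "\<dots> \<le> (\<bar>B\<bar> + 1) * (e / (\<bar>B\<bar> + 1))"
      using F by (intro mult_left_mono) auto
    finally show ?thesis by simp
  qed
  then have "cmod (\<phi> x) \<le> 0" by (rule field_le_epsilon[of _ 0, simplified])
  then show ?thesis by simp
qed

section \<open>Bounded operators\<close>

lemma bop_in_l2: "T \<in> bop I \<Longrightarrow> x \<in> l2 I \<Longrightarrow> T x \<in> l2 I"
  and bop_outside: "T \<in> bop I \<Longrightarrow> x \<notin> l2 I \<Longrightarrow> T x = 0"
  and bop_add_arg: "T \<in> bop I \<Longrightarrow> x \<in> l2 I \<Longrightarrow> y \<in> l2 I \<Longrightarrow> T (x + y) = T x + T y"
  and bop_scale_arg: "T \<in> bop I \<Longrightarrow> x \<in> l2 I \<Longrightarrow> T (\<lambda>\<alpha>. c * x \<alpha>) = (\<lambda>\<alpha>. c * T x \<alpha>)"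
  unfolding bop_def by blast+

lemma bop_bound:
  assumes "T \<in> bop I"
  obtains B where "0 \<le> B" "\<And>x. x \<in> l2 I \<Longrightarrow> l2_norm (T x) \<le> B * l2_norm x"
proof -
  obtain B where B: "\<forall>x\<in>l2 I. l2_norm (T x) \<le> B * l2_norm x"
    using assms unfolding bop_def by blast
  have "l2_norm (T x) \<le> \<bar>B\<bar> * l2_norm x" if "x \<in> l2 I" for x
    by (rule order.trans[OF B[rule_format, OF that]]) (auto intro: mult_right_mono)
  then show ?thesis using that[of "\<bar>B\<bar>"] by simp
qed

lemma bopI:
  assumes "\<And>x. x \<in> l2 I \<Longrightarrow> T x \<in> l2 I" "\<And>x. x \<notin> l2 I \<Longrightarrow> T x = 0"
    and "\<And>x y. x \<in> l2 I \<Longrightarrow> y \<in> l2 I \<Longrightarrow> T (x + y) = T x + T y"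
    and "\<And>c x. x \<in> l2 I \<Longrightarrow> T (\<lambda>\<alpha>. c * x \<alpha>) = (\<lambda>\<alpha>. c * T x \<alpha>)"
    and "\<And>x. x \<in> l2 I \<Longrightarrow> l2_norm (T x) \<le> B * l2_norm x"
  shows "T \<in> bop I"
  using assms unfolding bop_def by blast

lemma bop_zero_arg:
  assumes "T \<in> bop I"
  shows "T 0 = 0"
proof -
  have "T (\<lambda>\<alpha>. 0 * 0 \<alpha>) = (\<lambda>\<alpha>. 0 * T 0 \<alpha>)"
    by (rule bop_scale_arg[OF assms l2_zero])
  then show ?thesis by (simp add: zero_fun_def)
qed

lemma bop_truncation:
  assumes T: "T \<in> bop I" and F: "finite F" "F \<subseteq> I"
  shows "T (truncation F x) \<alpha> = (\<Sum>\<beta>\<in>F. x \<beta> * T (ket \<beta>) \<alpha>)"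
  using F
proof (induction F)
  case empty
  have "truncation {} x = 0" by (auto simp: truncation_def)
  then have "T (truncation {} x) = 0" using bop_zero_arg[OF T] by metis
  then show ?case by simp
next
  case (insert \<beta> F)
  then have "T (truncation (insert \<beta> F) x) = T (truncation F x) + (\<lambda>\<gamma>. x \<beta> * T (ket \<beta>) \<gamma>)"
    by (simp only: truncation_insert bop_add_arg[OF T] bop_scale_arg[OF T] truncation_in_l2
          l2_scale ket_in_l2 insert_subset simp_thms)
  then show ?case using insert by simp
qed

text \<open>For each fixed \<alpha>, the coordinate \<open>T x \<alpha> - S x \<alpha>\<close> is a
  bounded linear functional of \<open>x\<close> that vanishes on the basis, hence everywhere on the
  carrier; off the carrier both operators are normalised to 0.\<close>

lemma bop_eqI:
  assumes T: "T \<in> bop I" and S: "S \<in> bop I"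
    and ket: "\<And>\<alpha>. \<alpha> \<in> I \<Longrightarrow> T (ket \<alpha>) = S (ket \<alpha>)"
  shows "T = S"
proof
  fix x
  obtain A where A: "\<And>x. x \<in> l2 I \<Longrightarrow> l2_norm (T x) \<le> A * l2_norm x"
    using bop_bound[OF T] by blast
  obtain B where B: "\<And>x. x \<in> l2 I \<Longrightarrow> l2_norm (S x) \<le> B * l2_norm x"
    using bop_bound[OF S] by blast
  show "T x = S x"
  proof (cases "x \<in> l2 I")
    case True
    have "T x \<alpha> - S x \<alpha> = 0" for \<alpha>
    proof (rule l2_functional_eq_0[where I = I and x = x and B = "A + B"])
      fix x assume x: "x \<in> l2 I"
      have "cmod (T x \<alpha> - S x \<alpha>) \<le> cmod (T x \<alpha>) + cmod (S x \<alpha>)"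
        by (rule norm_triangle_ineq4)
      also have "\<dots> \<le> l2_norm (T x) + l2_norm (S x)"
        using x by (intro add_mono norm_le_l2_norm[where I = I] bop_in_l2[OF T] bop_in_l2[OF S])
      also have "\<dots> \<le> (A + B) * l2_norm x"
        using A[OF x] B[OF x] by (simp add: distrib_right)
      finally show "cmod (T x \<alpha> - S x \<alpha>) \<le> (A + B) * l2_norm x" .
    next
      fix x y assume "x \<in> l2 I" "y \<in> l2 I"
      then show "T (x + y) \<alpha> - S (x + y) \<alpha> = T x \<alpha> - S x \<alpha> + (T y \<alpha> - S y \<alpha>)"
        by (simp only: bop_add_arg[OF T] bop_add_arg[OF S]) simp
    next
      fix c x assume "x \<in> l2 I"
      then show "T (\<lambda>\<alpha>. c * x \<alpha>) \<alpha> - S (\<lambda>\<alpha>. c * x \<alpha>) \<alpha> = c * (T x \<alpha> - S x \<alpha>)"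
        by (simp only: bop_scale_arg[OF T] bop_scale_arg[OF S] right_diff_distrib)
    qed (simp_all only: True ket diff_self)
    then show ?thesis by auto
  qed (simp add: bop_outside[OF T] bop_outside[OF S])
qed

lemma bop_comp:
  assumes S: "S \<in> bop I" and T: "T \<in> bop I"
  shows "S \<circ> T \<in> bop I"
proof -
  obtain A where A: "0 \<le> A" "\<And>x. x \<in> l2 I \<Longrightarrow> l2_norm (S x) \<le> A * l2_norm x"
    using bop_bound[OF S] by blast
  obtain B where B: "\<And>x. x \<in> l2 I \<Longrightarrow> l2_norm (T x) \<le> B * l2_norm x"
    using bop_bound[OF T] by blast
  show ?thesis
  proof (rule bopI[where B = "A * B"])
    fix x assume x: "x \<in> l2 I"
    have "l2_norm (S (T x)) \<le> A * l2_norm (T x)" using A x T by (simp add: bop_in_l2[OF T])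
    also have "\<dots> \<le> A * (B * l2_norm x)" using A B x by (intro mult_left_mono) auto
    finally show "l2_norm ((S \<circ> T) x) \<le> A * B * l2_norm x" by simp
  qed (use S T in \<open>simp_all add: bop_in_l2 bop_outside[OF T] bop_zero_arg[OF S]
      bop_add_arg[OF S] bop_add_arg[OF T] bop_scale_arg[OF S] bop_scale_arg[OF T]\<close>)
qed

lemma id_op_in_bop: "id_op I \<in> bop I"
  by (rule bopI[where B = 1]) (auto simp: id_op_def l2_add l2_scale)

lemma subspace_bop: "l2_op.subspace (bop I)"
proof (rule l2_op.subspaceI)
  show "0 \<in> bop I" by (rule bopI[where B = 0]) (auto simp: fun_eq_iff)
next
  fix S T assume S: "S \<in> bop I" and T: "T \<in> bop I"
  obtain A where A: "\<And>x. x \<in> l2 I \<Longrightarrow> l2_norm (S x) \<le> A * l2_norm x"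
    using bop_bound[OF S] by blast
  obtain B where B: "\<And>x. x \<in> l2 I \<Longrightarrow> l2_norm (T x) \<le> B * l2_norm x"
    using bop_bound[OF T] by blast
  have "(\<lambda>x. S x + T x) \<in> bop I"
  proof (rule bopI[where B = "A + B"])
    fix x assume x: "x \<in> l2 I"
    have "l2_norm (S x + T x) \<le> l2_norm (S x) + l2_norm (T x)"
      by (intro l2_norm_triangle[where I = I] bop_in_l2[OF S] bop_in_l2[OF T] x)
    also have "\<dots> \<le> (A + B) * l2_norm x" using A[OF x] B[OF x] by (simp add: distrib_right)
    finally show "l2_norm (S x + T x) \<le> (A + B) * l2_norm x" .
  next
    fix x y assume "x \<in> l2 I" "y \<in> l2 I"
    then show "S (x + y) + T (x + y) = S x + T x + (S y + T y)"
      by (simp only: bop_add_arg[OF S] bop_add_arg[OF T] ac_simps)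
  next
    fix c x assume "x \<in> l2 I"
    then show "S (\<lambda>\<alpha>. c * x \<alpha>) + T (\<lambda>\<alpha>. c * x \<alpha>) = (\<lambda>\<alpha>. c * (S x + T x) \<alpha>)"
      by (simp only: bop_scale_arg[OF S] bop_scale_arg[OF T] plus_fun_def distrib_left)
  next
    fix x assume "x \<notin> l2 I"
    then show "S x + T x = 0"
      using bop_outside[OF S] bop_outside[OF T] by (metis add_0_left)
  qed (intro l2_add bop_in_l2[OF S] bop_in_l2[OF T])
  then show "S + T \<in> bop I" by (subst plus_fun_def)
next
  fix c T assume T: "T \<in> bop I"
  obtain B where B: "\<And>x. x \<in> l2 I \<Longrightarrow> l2_norm (T x) \<le> B * l2_norm x"
    using bop_bound[OF T] by blast
  have "(\<lambda>x \<alpha>. c * T x \<alpha>) \<in> bop I"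
  proof (rule bopI[where B = "cmod c * B"])
    fix x assume "x \<in> l2 I"
    then show "l2_norm (\<lambda>\<alpha>. c * T x \<alpha>) \<le> cmod c * B * l2_norm x"
      using B[of x] by (simp add: l2_norm_scale mult.assoc mult_left_mono)
  next
    fix x y assume "x \<in> l2 I" "y \<in> l2 I"
    then show "(\<lambda>\<alpha>. c * T (x + y) \<alpha>) = (\<lambda>\<alpha>. c * T x \<alpha>) + (\<lambda>\<alpha>. c * T y \<alpha>)"
      by (simp only: bop_add_arg[OF T]) (simp add: plus_fun_def distrib_left)
  next
    fix d x assume "x \<in> l2 I"
    then show "(\<lambda>\<alpha>. c * T (\<lambda>\<alpha>. d * x \<alpha>) \<alpha>) = (\<lambda>\<alpha>. d * (c * T x \<alpha>))"
      by (simp only: bop_scale_arg[OF T] mult.left_commute)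
  next
    fix x assume "x \<notin> l2 I"
    then show "(\<lambda>\<alpha>. c * T x \<alpha>) = 0"
      by (simp add: bop_outside[OF T] zero_fun_def)
  qed (intro l2_scale bop_in_l2[OF T])
  then show "scale_op c T \<in> bop I" by (subst scale_op_def)
qed

section \<open>The operator norm and its metric\<close>

lemma l2_norm_le_op_norm_unit:
  assumes T: "T \<in> bop I" and x: "x \<in> l2 I" "l2_norm x \<le> 1"
  shows "l2_norm (T x) \<le> op_norm I T"
proof -
  obtain B where B: "0 \<le> B" "\<And>x. x \<in> l2 I \<Longrightarrow> l2_norm (T x) \<le> B * l2_norm x"
    using bop_bound[OF T] by blast
  have "bdd_above ((\<lambda>x. l2_norm (T x)) ` {x \<in> l2 I. l2_norm x \<le> 1})"
  proof (rule bdd_aboveI2)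
    fix y assume "y \<in> {x \<in> l2 I. l2_norm x \<le> 1}"
    then show "l2_norm (T y) \<le> B"
      using B(2)[of y] mult_left_mono[of "l2_norm y" 1 B] B(1) by simp
  qed
  then show ?thesis
    using x T by (auto simp: op_norm_def intro: cSUP_upper)
qed

lemma l2_norm_le_op_norm:
  assumes T: "T \<in> bop I" and x: "x \<in> l2 I"
  shows "l2_norm (T x) \<le> op_norm I T * l2_norm x"
proof (cases "l2_norm x = 0")
  case True
  then have "x = 0" using l2_norm_eq_0[OF x] by simp
  then show ?thesis by (simp add: bop_zero_arg[OF T])
next
  case False
  then have pos: "0 < l2_norm x" using l2_norm_nonneg[of x] by linarith
  define u where "u = (\<lambda>\<alpha>. complex_of_real (inverse (l2_norm x)) * x \<alpha>)"
  have u: "u \<in> l2 I" unfolding u_def using x by (rule l2_scale)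
  have "l2_norm u = 1" using pos by (simp add: u_def l2_norm_scale norm_inverse)
  then have "l2_norm (T u) \<le> op_norm I T"
    by (intro l2_norm_le_op_norm_unit[OF T u]) simp
  moreover have "l2_norm (T u) = inverse (l2_norm x) * l2_norm (T x)"
    using pos by (simp add: u_def bop_scale_arg[OF T x] l2_norm_scale norm_inverse)
  ultimately show ?thesis using pos by (simp add: field_simps)
qed

lemma op_norm_leI:
  assumes "0 \<le> B" "\<And>x. x \<in> l2 I \<Longrightarrow> l2_norm x \<le> 1 \<Longrightarrow> l2_norm (T x) \<le> B"
  shows "op_norm I T \<le> B"
proof -
  have "0 \<in> {x \<in> l2 I. l2_norm x \<le> 1}" by simp
  then have "{x \<in> l2 I. l2_norm x \<le> 1} \<noteq> {}" by blast
  then show ?thesis using assms by (auto simp: op_norm_def intro!: cSUP_least)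
qed

lemma op_norm_nonneg: "0 \<le> op_norm I T"
proof (cases "T \<in> bop I")
  case True
  show ?thesis
    using l2_norm_le_op_norm_unit[OF True, of 0] by (simp add: bop_zero_arg[OF True])
qed (simp add: op_norm_def)

lemma Metric_space_bop: "Metric_space (bop I) (\<lambda>S T. op_norm I (S - T))"
proof
  fix S T :: "'a l2_op"
  \<comment> \<open>Symmetry is required for arbitrary arguments, and \<open>op_norm\<close> is 0
    off \<open>bop I\<close>. So \<open>S - T\<close> and \<open>T - S\<close> must be shown to lie
    in \<open>bop I\<close> simultaneously.\<close>
  have "T - S = scale_op (-1) (S - T)" "S - T = scale_op (-1) (T - S)"
    by (auto simp: scale_op_def fun_eq_iff)
  then have "S - T \<in> bop I \<longleftrightarrow> T - S \<in> bop I"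
    using l2_op.subspace_scale[OF subspace_bop] by metis
  then show "op_norm I (S - T) = op_norm I (T - S)"
    by (simp add: op_norm_def l2_norm_minus_commute)
next
  fix S T :: "'a l2_op" assume ST: "S \<in> bop I" "T \<in> bop I"
  then have d: "S - T \<in> bop I" by (rule l2_op.subspace_diff[OF subspace_bop])
  show "op_norm I (S - T) = 0 \<longleftrightarrow> S = T"
  proof
    assume 0: "op_norm I (S - T) = 0"
    have "S x = T x" for x
    proof (cases "x \<in> l2 I")
      case True
      have "l2_norm (S x - T x) \<le> 0" using l2_norm_le_op_norm[OF d True] 0 by simp
      then show ?thesis
        using l2_norm_eq_0[of "S x - T x" I] ST True l2_norm_nonneg[of "S x - T x"]
        by (simp add: l2_diff bop_in_l2[of _ I])
    qed (use ST in \<open>simp add: bop_outside\<close>)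
    then show "S = T" by auto
  next
    assume "S = T"
    then show "op_norm I (S - T) = 0"
      using op_norm_leI[of 0 I 0] op_norm_nonneg[of I 0] by simp
  qed
next
  fix S T U :: "'a l2_op" assume S: "S \<in> bop I" and T: "T \<in> bop I" and U: "U \<in> bop I"
  have ST: "S - T \<in> bop I" and TU: "T - U \<in> bop I"
    using S T U l2_op.subspace_diff[OF subspace_bop] by blast+
  show "op_norm I (S - U) \<le> op_norm I (S - T) + op_norm I (T - U)"
  proof (rule op_norm_leI)
    fix x assume x: "x \<in> l2 I" "l2_norm x \<le> 1"
    have "(S - U) x = (S - T) x + (T - U) x" by simp
    then have "l2_norm ((S - U) x) \<le> l2_norm ((S - T) x) + l2_norm ((T - U) x)"
      using l2_norm_triangle[OF bop_in_l2[OF ST x(1)] bop_in_l2[OF TU x(1)]] by (simp only:)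
    also have "\<dots> \<le> op_norm I (S - T) + op_norm I (T - U)"
      by (intro add_mono l2_norm_le_op_norm_unit ST TU x)
    finally show "l2_norm ((S - U) x) \<le> op_norm I (S - T) + op_norm I (T - U)" .
  qed (simp add: op_norm_nonneg)
qed (rule op_norm_nonneg)

interpretation bop: Metric_space "bop I" "\<lambda>S T. op_norm I (S - T)" for I
  by (rule Metric_space_bop)

subsection \<open>Adjoints\<close>

text \<open>The formula for \<open>U\<close> is forced by testing on basis vectors. Boundedness
  comes from testing \<open>T\<close> on a finite section of \<open>U y\<close> itself: with
  \<open>N\<close> the norm of that section, this gives
  \<open>N * N \<le> N * (B * l2_norm y)\<close>, and \<open>N\<close> cancels.\<close>

lemma adjoint_exists:
  assumes T: "T \<in> bop I"
  shows "\<exists>U\<in>bop I. \<forall>x\<in>l2 I. \<forall>y\<in>l2 I. l2_inner (T x) y = l2_inner x (U y)"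
proof -
  obtain B where B: "0 \<le> B" "\<And>x. x \<in> l2 I \<Longrightarrow> l2_norm (T x) \<le> B * l2_norm x"
    using bop_bound[OF T] by blast
  define U where
    "U y = (\<lambda>\<alpha>. if y \<in> l2 I \<and> \<alpha> \<in> I then cnj (l2_inner (T (ket \<alpha>)) y) else 0)" for y
  have bound: "L2_set (\<lambda>\<alpha>. cmod (U y \<alpha>)) F \<le> B * l2_norm y"
    if y: "y \<in> l2 I" and F: "finite F" for y F
  proof -
    let ?N = "L2_set (\<lambda>\<alpha>. cmod (U y \<alpha>)) F"
    have inner_trunc: "l2_inner (T (truncation G c)) y = (\<Sum>\<alpha>\<in>G. c \<alpha> * l2_inner (T (ket \<alpha>)) y)"
      if "finite G" "G \<subseteq> I" for G c
      using that
    proof (induction G)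
      case empty
      have "truncation {} c = 0" by (auto simp: truncation_def)
      then have "T (truncation {} c) = 0" using bop_zero_arg[OF T] by metis
      then show ?case by (simp only: l2_inner_zero sum.empty)
    next
      case (insert \<beta> G)
      then have "T (truncation (insert \<beta> G) c)
          = T (truncation G c) + (\<lambda>\<gamma>. c \<beta> * T (ket \<beta>) \<gamma>)"
        by (simp only: truncation_insert bop_add_arg[OF T] bop_scale_arg[OF T] truncation_in_l2
              l2_scale ket_in_l2 insert_subset simp_thms)
      then have "l2_inner (T (truncation (insert \<beta> G) c)) y
          = l2_inner (T (truncation G c)) y + c \<beta> * l2_inner (T (ket \<beta>)) y"
        using insert y T
        by (simp only: l2_inner_add_left[where I = I] l2_inner_scale_left truncation_in_l2
            bop_in_l2[OF T] l2_scale ket_in_l2 insert_subset simp_thms)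
      then show ?case using insert by simp
    qed
    have N: "L2_set (\<lambda>\<alpha>. cmod (U y \<alpha>)) (F \<inter> I) = ?N"
      unfolding L2_set_def using F
      by (intro arg_cong[where f = sqrt] sum.mono_neutral_left) (auto simp: U_def)
    have "complex_of_real (?N\<^sup>2) = (\<Sum>\<alpha>\<in>F \<inter> I. U y \<alpha> * cnj (U y \<alpha>))"
      unfolding N[symmetric] by (simp add: L2_set_def sum_nonneg complex_norm_square[symmetric])
    also have "\<dots> = (\<Sum>\<alpha>\<in>F \<inter> I. U y \<alpha> * l2_inner (T (ket \<alpha>)) y)"
      using y by (intro sum.cong) (auto simp: U_def)
    also have "\<dots> = l2_inner (T (truncation (F \<inter> I) (U y))) y"
      using F by (subst inner_trunc) auto
    finally have "?N\<^sup>2 = cmod (l2_inner (T (truncation (F \<inter> I) (U y))) y)"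
      by (metis norm_of_real abs_power2)
    also have "\<dots> \<le> l2_norm (T (truncation (F \<inter> I) (U y))) * l2_norm y"
      using F y by (intro l2_Cauchy_Schwarz[where I = I] bop_in_l2[OF T] truncation_in_l2) auto
    also have "\<dots> \<le> (B * l2_norm (truncation (F \<inter> I) (U y))) * l2_norm y"
      using F by (intro mult_right_mono B truncation_in_l2) auto
    also have "\<dots> = ?N * (B * l2_norm y)"
      using F by (simp add: l2_norm_truncation[where I = I] N)
    finally have *: "?N * ?N \<le> ?N * (B * l2_norm y)" by (simp add: power2_eq_square)
    show ?thesis
    proof (cases "?N = 0")
      case False
      then have "0 < ?N" using L2_set_nonneg[of "\<lambda>\<alpha>. cmod (U y \<alpha>)" F] by linarith
      then show ?thesis using * mult_le_cancel_left_pos by blast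
    qed (simp add: B)
  qed
  have in_l2: "U y \<in> l2 I" if "y \<in> l2 I" for y
    by (rule l2_memI[OF _ bound[OF that]]) (simp add: U_def)
  have norm: "l2_norm (U y) \<le> B * l2_norm y" if "y \<in> l2 I" for y
    by (rule l2_norm_leI[where I = I, OF _ bound[OF that]]) (simp add: U_def)
  have "U \<in> bop I"
    by (rule bopI[OF in_l2 _ _ _ norm])
       (auto simp: U_def fun_eq_iff l2_add l2_scale l2_inner_scale_right
          l2_inner_add_right[where I = I] bop_in_l2[OF T] ket_in_l2)
  \<comment> \<open>On basis vectors the identity is the definition of \<open>U\<close>; density of
    their span extends it to all \<open>x\<close>.\<close>
  moreover have "l2_inner (T x) y - l2_inner x (U y) = 0" if x: "x \<in> l2 I" and y: "y \<in> l2 I" for x y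
  proof (rule l2_functional_eq_0[where I = I and x = x and B = "B * l2_norm y + l2_norm (U y)"])
    fix x assume x: "x \<in> l2 I"
    have "cmod (l2_inner (T x) y - l2_inner x (U y))
        \<le> cmod (l2_inner (T x) y) + cmod (l2_inner x (U y))"
      by (rule norm_triangle_ineq4)
    also have "\<dots> \<le> l2_norm (T x) * l2_norm y + l2_norm x * l2_norm (U y)"
      using x y by (intro add_mono l2_Cauchy_Schwarz[where I = I] bop_in_l2[OF T] in_l2)
    also have "\<dots> \<le> (B * l2_norm x) * l2_norm y + l2_norm x * l2_norm (U y)"
      using x by (intro add_mono mult_right_mono B) auto
    finally show "cmod (l2_inner (T x) y - l2_inner x (U y))
        \<le> (B * l2_norm y + l2_norm (U y)) * l2_norm x" by (simp add: algebra_simps)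
  next
    fix x z assume xz: "x \<in> l2 I" "z \<in> l2 I"
    show "l2_inner (T (x + z)) y - l2_inner (x + z) (U y)
        = l2_inner (T x) y - l2_inner x (U y) + (l2_inner (T z) y - l2_inner z (U y))"
      using xz T y in_l2[OF y]
      by (simp only: bop_add_arg[OF T] l2_inner_add_left[where I = I] bop_in_l2[OF T]) simp
  next
    fix c x assume "x \<in> l2 I"
    then show "l2_inner (T (\<lambda>\<alpha>. c * x \<alpha>)) y - l2_inner (\<lambda>\<alpha>. c * x \<alpha>) (U y)
        = c * (l2_inner (T x) y - l2_inner x (U y))"
      by (simp add: bop_scale_arg[OF T] l2_inner_scale_left right_diff_distrib)
  next
    fix \<alpha> assume "\<alpha> \<in> I"
    then show "l2_inner (T (ket \<alpha>)) y - l2_inner (ket \<alpha>) (U y) = 0"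
      using y by (simp add: U_def)
  qed (rule x)
  ultimately show ?thesis by auto
qed

text \<open>Since \<open>adj_op\<close> is a definite description, uniqueness is needed besides
  existence; the defining identity on pairs of basis vectors determines all matrix entries.\<close>

lemma
  assumes T: "T \<in> bop I"
  shows adj_op_in_bop: "adj_op I T \<in> bop I"
    and adj_op_inner:
      "\<And>x y. x \<in> l2 I \<Longrightarrow> y \<in> l2 I \<Longrightarrow> l2_inner x (adj_op I T y) = l2_inner (T x) y"
proof -
  let ?P = "\<lambda>U. U \<in> bop I \<and> (\<forall>x\<in>l2 I. \<forall>y\<in>l2 I. l2_inner (T x) y = l2_inner x (U y))"
  have "\<exists>!U. ?P U"
  proof (rule ex_ex1I)
    show "\<exists>U. ?P U" using adjoint_exists[OF T] by blast
  next
    fix U V assume U: "?P U" and V: "?P V"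
    have "U (ket \<alpha>) \<beta> = V (ket \<alpha>) \<beta>" if "\<alpha> \<in> I" for \<alpha> \<beta>
    proof (cases "\<beta> \<in> I")
      case True
      then have "l2_inner (ket \<beta>) (U (ket \<alpha>)) = l2_inner (ket \<beta>) (V (ket \<alpha>))"
        using U V that by (metis ket_in_l2)
      then show ?thesis by simp
    next
      case False
      then show ?thesis
        using U V that by (metis bop_in_l2 ket_in_l2 l2_outside)
    qed
    then show "U = V" using U V by (intro bop_eqI[of U I V]) auto
  qed
  then have "?P (adj_op I T)" unfolding adj_op_def by (rule theI')
  then show "adj_op I T \<in> bop I"
    and "\<And>x y. x \<in> l2 I \<Longrightarrow> y \<in> l2 I \<Longrightarrow> l2_inner x (adj_op I T y) = l2_inner (T x) y"
    by auto
qed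

lemma adj_op_ket:
  assumes "T \<in> bop I" "\<alpha> \<in> I" "y \<in> l2 I"
  shows "adj_op I T y \<alpha> = l2_inner y (T (ket \<alpha>))"
proof -
  have "cnj (adj_op I T y \<alpha>) = l2_inner (T (ket \<alpha>)) y"
    using adj_op_inner[OF assms(1) ket_in_l2[OF assms(2)] assms(3)] by simp
  also have "\<dots> = cnj (l2_inner y (T (ket \<alpha>)))" by (rule l2_inner_commute)
  finally show ?thesis by simp
qed

section \<open>Operator topologies\<close>

lemma topspace_norm_op_topology [simp]: "topspace (norm_op_topology I) = bop I"
  by (simp add: norm_op_topology_def)

lemma topspace_sot [simp]: "topspace (sot I) = bop I"
  by (auto simp: sot_def topspace_pullback_topology bop_in_l2[of _ I])

lemma topspace_wot [simp]: "topspace (wot I) = bop I"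
  by (auto simp: wot_def topspace_pullback_topology)

lemma continuous_map_wot_inner:
  assumes "x \<in> l2 I" "y \<in> l2 I"
  shows "continuous_map (wot I) euclidean (\<lambda>T. l2_inner (T x) y)"
proof -
  have "continuous_map (wot I) euclidean
      ((\<lambda>f. f (x, y)) \<circ> (\<lambda>T. \<lambda>(x, y)\<in>l2 I \<times> l2 I. l2_inner (T x) y))"
    unfolding wot_def using assms
    by (intro continuous_map_pullback continuous_map_product_projection) auto
  then show ?thesis
    by (rule continuous_map_eq) (use assms in auto)
qed

lemma continuous_map_sot_apply:
  assumes "x \<in> l2 I"
  shows "continuous_map (sot I) (l2_topology I) (\<lambda>T. T x)"
proof -
  have "continuous_map (sot I) (l2_topology I) ((\<lambda>f. f x) \<circ> (\<lambda>T. \<lambda>x\<in>l2 I. T x))"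
    unfolding sot_def using assms
    by (intro continuous_map_pullback continuous_map_product_projection[of x "l2 I" "\<lambda>_. l2_topology I"])
  then show ?thesis
    by (rule continuous_map_eq) (use assms in auto)
qed

lemma continuous_map_l2_inner:
  assumes y: "y \<in> l2 I"
  shows "continuous_map (l2_topology I) euclidean (\<lambda>x. l2_inner x y)"
  unfolding l2_topology_def mtopology_is_euclidean[symmetric]
proof (rule l2.metric_continuous_map[THEN iffD2, OF Met_TC.Metric_space_axioms], safe)
  fix a :: "'a \<Rightarrow> complex" and e :: real assume a: "a \<in> l2 I" and e: "0 < e"
  define d where "d = e / (l2_norm y + 1)"
  have pos: "0 < l2_norm y + 1" using l2_norm_nonneg[of y] by linarith
  have "dist (l2_inner a y) (l2_inner x y) < e" if x: "x \<in> l2 I" and "l2_norm (a - x) < d" for x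
  proof -
    have "dist (l2_inner a y) (l2_inner x y) = cmod (l2_inner (a - x) y)"
      by (simp add: dist_norm l2_inner_diff_left[OF a x y])
    also have "\<dots> \<le> l2_norm (a - x) * l2_norm y"
      using a x y by (intro l2_Cauchy_Schwarz[where I = I] l2_diff)
    also have "\<dots> \<le> l2_norm (a - x) * (l2_norm y + 1)"
      by (intro mult_left_mono) auto
    also have "\<dots> < d * (l2_norm y + 1)"
      using that pos by (intro mult_strict_right_mono) auto
    finally show ?thesis using pos by (simp add: d_def)
  qed
  moreover have "0 < d" using e pos by (simp add: d_def)
  ultimately show "\<exists>\<delta>>0. \<forall>x. x \<in> l2 I \<and> l2_norm (a - x) < \<delta> \<longrightarrow>
      dist (l2_inner a y) (l2_inner x y) < e"
    by blast
qed auto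

text \<open>Needed to see that equations between matrix coefficients define sets closed in the norm
  topology, as membership in \<open>norm_closed_algebra\<close> demands.\<close>

lemma continuous_map_norm_op_apply:
  assumes x: "x \<in> l2 I"
  shows "continuous_map (norm_op_topology I) (l2_topology I) (\<lambda>T. T x)"
  unfolding l2_topology_def norm_op_topology_def
proof (rule bop.metric_continuous_map[THEN iffD2, OF Metric_space_l2], intro conjI ballI allI impI)
  fix S and e :: real assume S: "S \<in> bop I" and e: "0 < e"
  define d where "d = e / (l2_norm x + 1)"
  have pos: "0 < l2_norm x + 1" using l2_norm_nonneg[of x] by linarith
  have "l2_norm (S x - T x) < e" if T: "T \<in> bop I" and "op_norm I (S - T) < d" for T
  proof -
    have "l2_norm (S x - T x) \<le> op_norm I (S - T) * l2_norm x"
      using l2_norm_le_op_norm[OF l2_op.subspace_diff[OF subspace_bop S T] x] by simp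
    also have "\<dots> \<le> op_norm I (S - T) * (l2_norm x + 1)"
      by (intro mult_left_mono op_norm_nonneg) auto
    also have "\<dots> < d * (l2_norm x + 1)"
      using that pos by (intro mult_strict_right_mono) auto
    finally show ?thesis using pos by (simp add: d_def)
  qed
  moreover have "0 < d" using e pos by (simp add: d_def)
  ultimately show "\<exists>\<delta>>0. \<forall>T. T \<in> bop I \<and> op_norm I (S - T) < \<delta> \<longrightarrow> l2_norm (S x - T x) < e"
    by blast
qed (use x in \<open>auto simp: bop_in_l2[of _ I]\<close>)

lemma continuous_map_norm_op_inner:
  assumes "x \<in> l2 I" "y \<in> l2 I"
  shows "continuous_map (norm_op_topology I) euclidean (\<lambda>T. l2_inner (T x) y)"
  using continuous_map_compose[OF continuous_map_norm_op_apply continuous_map_l2_inner] assms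
  by (auto simp: o_def)

lemma continuous_map_sot_wot: "continuous_map (sot I) (wot I) id"
  unfolding wot_def
proof (rule continuous_map_pullback')
  have "continuous_map (sot I) euclidean (\<lambda>T. l2_inner (T x) y)" if "x \<in> l2 I" "y \<in> l2 I" for x y
    using continuous_map_compose[OF continuous_map_sot_apply continuous_map_l2_inner] that
    by (auto simp: o_def)
  then show "continuous_map (sot I) (product_topology (\<lambda>_. euclidean) (l2 I \<times> l2 I))
      ((\<lambda>T. \<lambda>(x, y)\<in>l2 I \<times> l2 I. l2_inner (T x) y) \<circ> id)"
    by (auto simp: continuous_map_componentwise)
qed auto

text \<open>Holds for every \<open>A\<close>. The reverse inclusion is special to
  \<open>span_star_product\<close> and comes from multi-Toeplitz operators lying in its strong
  closure.\<close>

lemma sot_closure_subset_wot_closure: "sot I closure_of A \<subseteq> wot I closure_of A"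
  using continuous_map_image_closure_subset[OF continuous_map_sot_wot, of I A] by simp

text \<open>The strong topology is pulled back from a product of norm topologies, where convergence
  is coordinatewise. A sequence converging at every vector therefore enters every neighbourhood of
  \<open>T\<close>.\<close>

lemma sot_closure_sequentialI:
  assumes T: "T \<in> bop I" and Q: "\<And>N. Q N \<in> bop I" "\<And>N. Q N \<in> A"
    and lim: "\<And>x. x \<in> l2 I \<Longrightarrow> (\<lambda>N. l2_norm (Q N x - T x)) \<longlonglongrightarrow> 0"
  shows "T \<in> sot I closure_of A"
  unfolding in_closure_of
proof (intro conjI allI impI)
  show "T \<in> topspace (sot I)" using T by simp
  let ?f = "\<lambda>T :: 'a l2_op. \<lambda>x\<in>l2 I. T x"
  have "limitin (product_topology (\<lambda>_. l2_topology I) (l2 I)) (\<lambda>N. ?f (Q N)) (?f T) sequentially"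
    unfolding limitin_componentwise
  proof (intro conjI ballI)
    fix x assume x: "x \<in> l2 I"
    show "limitin (l2_topology I) (\<lambda>N. ?f (Q N) x) (?f T x) sequentially"
      unfolding l2_topology_def l2.limitin_metric_dist_null
      using x lim[OF x] by (simp add: bop_in_l2[OF T] bop_in_l2[OF Q(1)])
  qed (auto simp: bop_in_l2[OF Q(1)])
  moreover fix U assume U: "T \<in> U \<and> openin (sot I) U"
  then obtain V where V: "openin (product_topology (\<lambda>_. l2_topology I) (l2 I)) V" "U = ?f -` V \<inter> bop I"
    by (auto simp: sot_def openin_pullback_topology)
  ultimately have "\<forall>\<^sub>F N in sequentially. ?f (Q N) \<in> V"
    using U by (intro limitinD) auto
  then obtain N where "?f (Q N) \<in> V" by (auto simp: eventually_sequentially)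
  then show "\<exists>S. S \<in> A \<and> S \<in> U" using Q V by auto
qed

text \<open>Stated for any topology in which matrix coefficients are continuous, so that it serves
  twice: for the multi-Toeplitz relations in \<open>wot\<close>, and for commutation with the right
  creation operators in the norm topology.\<close>

lemma closedin_bop_equations:
  assumes X: "topspace X = bop I"
    and cont: "\<And>x y. x \<in> l2 I \<Longrightarrow> y \<in> l2 I \<Longrightarrow> continuous_map X euclidean (\<lambda>T. l2_inner (T x) y)"
    and E: "\<And>x y x' y' c. (x, y, x', y', c) \<in> E \<Longrightarrow> {x, y, x', y'} \<subseteq> l2 I"
  shows "closedin X {T \<in> bop I. \<forall>(x, y, x', y', c)\<in>E. l2_inner (T x) y = c * l2_inner (T x') y'}"
proof -
  define C where
    "C = (\<lambda>(x, y, x', y', c). {T \<in> topspace X. l2_inner (T x) y - c * l2_inner (T x') y' \<in> {0}})"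
  have "closedin X (C e)" if "e \<in> E" for e
  proof -
    obtain x y x' y' c where e: "e = (x, y, x', y', c)" by (cases e)
    \<comment> \<open>The factor \<open>c\<close> is absorbed, conjugated, into the second argument
      of the inner product, which turns the scaled coefficient into another coefficient covered by
      \<open>cont\<close>.\<close>
    have "continuous_map X euclidean (\<lambda>T. l2_inner (T x) y - c * l2_inner (T x') y')"
      using E[OF that[unfolded e]] l2_inner_scale_right[of _ "cnj c" y', simplified, symmetric]
      by (auto intro!: continuous_map_diff cont l2_scale)
    then show ?thesis
      unfolding C_def e prod.case by (rule closedin_continuous_map_preimage) auto
  qed
  then have "closedin X (\<Inter> (insert (topspace X) (C ` E)))"
    by (intro closedin_Inter) auto
  also have "\<Inter> (insert (topspace X) (C ` E))
      = {T \<in> bop I. \<forall>(x, y, x', y', c)\<in>E. l2_inner (T x) y = c * l2_inner (T x') y'}"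
    by (auto simp: C_def X split: prod.splits)
  finally show ?thesis .
qed

section \<open>Shift operators\<close>

text \<open>Injectivity of \<open>\<phi>\<close> on \<open>D\<close> means that each coordinate of
  \<open>x\<close> is read at most once, so the norm cannot grow. Ampliated creation operators have
  this form.\<close>

lemma partial_shift_in_bop:
  assumes D: "D \<subseteq> I" "inj_on \<phi> D" "\<phi> ` D \<subseteq> I"
  shows "(\<lambda>x. if x \<in> l2 I then (\<lambda>\<alpha>. if \<alpha> \<in> D then x (\<phi> \<alpha>) else 0) else 0) \<in> bop I"
    (is "?V \<in> _")
proof -
  have bound: "L2_set (\<lambda>\<alpha>. cmod (?V x \<alpha>)) F \<le> l2_norm x" if x: "x \<in> l2 I" and F: "finite F" for x F
  proof -
    have "(\<Sum>\<alpha>\<in>F. (cmod (?V x \<alpha>))\<^sup>2) = (\<Sum>\<alpha>\<in>F \<inter> D. (cmod (x (\<phi> \<alpha>)))\<^sup>2)"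
      using F x by (intro sum.mono_neutral_cong_right) auto
    also have "\<dots> = (\<Sum>\<beta>\<in>\<phi> ` (F \<inter> D). (cmod (x \<beta>))\<^sup>2)"
      using D(2) by (subst sum.reindex) (auto intro: inj_on_subset)
    finally show ?thesis
      using L2_set_le_l2_norm[OF x, of "\<phi> ` (F \<inter> D)"] F by (simp add: L2_set_def)
  qed
  have outside: "?V x \<alpha> = 0" if "\<alpha> \<notin> I" for x \<alpha>
    using that D by auto
  show ?thesis
  proof (rule bopI[where B = 1])
    fix x assume x: "x \<in> l2 I"
    show "?V x \<in> l2 I" by (rule l2_memI[OF outside bound[OF x]])
    show "l2_norm (?V x) \<le> 1 * l2_norm x"
      unfolding mult_1 by (rule l2_norm_leI[where I = I, OF outside bound[OF x]])
  next
    fix x y assume "x \<in> l2 I" "y \<in> l2 I"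
    then show "?V (x + y) = ?V x + ?V y"
      using l2_add[of x I y] by (auto simp: fun_eq_iff)
  qed (auto simp: l2_scale)
qed

lemma multi_words_upd:
  "\<alpha> \<in> multi_words k n \<Longrightarrow> i \<in> {1..k} \<Longrightarrow> w \<in> words (n i) \<Longrightarrow> \<alpha>(i := w) \<in> multi_words k n"
  by (auto simp: multi_words_def PiE_def Pi_def extensional_def)

lemma multi_words_nth: "\<alpha> \<in> multi_words k n \<Longrightarrow> i \<in> {1..k} \<Longrightarrow> \<alpha> i \<in> words (n i)"
  by (auto simp: multi_words_def)

text \<open>A slice is an injectively indexed subfamily of \<open>x\<close>. Membership matters
  because creation operators return 0 on families outside the carrier.\<close>

lemma slice_in_l2:
  assumes x: "x \<in> l2 (multi_words k n)" and i: "i \<in> {1..k}"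
  shows "(\<lambda>\<beta>. x (\<alpha>(i := \<beta>))) \<in> l2 (words (n i))"
proof (rule l2_memI[where C = "l2_norm x"])
  fix \<beta> assume "\<beta> \<notin> words (n i)"
  then have "\<alpha>(i := \<beta>) \<notin> multi_words k n"
    using multi_words_nth[of "\<alpha>(i := \<beta>)" k n i] i by auto
  then show "x (\<alpha>(i := \<beta>)) = 0" using x by (simp add: l2_outside)
next
  fix F :: "nat list set" assume "finite F"
  then show "L2_set (\<lambda>\<beta>. cmod (x (\<alpha>(i := \<beta>)))) F \<le> l2_norm x"
    using L2_set_le_l2_norm[OF x, of "(\<lambda>\<beta>. \<alpha>(i := \<beta>)) ` F"]
    by (simp add: L2_set_def sum.reindex inj_on_def fun_upd_eqD o_def)
qed

text \<open>Treats left and right creation together: \<open>h\<close> reads the letter that was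
  added and \<open>t\<close> removes it. The instances are \<open>hd\<close> with \<open>tl\<close>
  and \<open>last\<close> with \<open>butlast\<close>.\<close>

context
  fixes k :: nat and n :: "nat \<Rightarrow> nat" and i :: nat
    and A :: "nat list l2_op" and h :: "nat list \<Rightarrow> nat" and t :: "nat list \<Rightarrow> nat list" and j :: nat
  assumes i: "i \<in> {1..k}"
    and A: "\<And>x. x \<in> l2 (words (n i)) \<Longrightarrow> A x = (\<lambda>\<beta>. if \<beta> \<noteq> [] \<and> h \<beta> = j then x (t \<beta>) else 0)"
    and inj: "\<And>\<beta> \<beta>'. \<beta> \<noteq> [] \<Longrightarrow> \<beta>' \<noteq> [] \<Longrightarrow> h \<beta> = h \<beta>' \<Longrightarrow> t \<beta> = t \<beta>' \<Longrightarrow> \<beta> = \<beta>'"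
    and t: "\<And>\<beta>. \<beta> \<in> words (n i) \<Longrightarrow> t \<beta> \<in> words (n i)"
begin

lemma ampliation_shift:
  "ampliation k n i A = (\<lambda>x. if x \<in> l2 (multi_words k n)
     then (\<lambda>\<alpha>. if \<alpha> \<in> {\<alpha> \<in> multi_words k n. \<alpha> i \<noteq> [] \<and> h (\<alpha> i) = j} then x (\<alpha>(i := t (\<alpha> i))) else 0)
     else 0)"
  unfolding ampliation_def by (intro ext) (auto simp: A[OF slice_in_l2[where n = n, OF _ i]])

lemma ampliation_shift_in_bop: "ampliation k n i A \<in> bop (multi_words k n)"
  unfolding ampliation_shift
proof (rule partial_shift_in_bop)
  show "inj_on (\<lambda>\<alpha>. \<alpha>(i := t (\<alpha> i))) {\<alpha> \<in> multi_words k n. \<alpha> i \<noteq> [] \<and> h (\<alpha> i) = j}"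
  proof (rule inj_onI)
    fix \<alpha> \<beta> assume eq: "\<alpha>(i := t (\<alpha> i)) = \<beta>(i := t (\<beta> i))"
      and "\<alpha> \<in> {\<alpha> \<in> multi_words k n. \<alpha> i \<noteq> [] \<and> h (\<alpha> i) = j}"
        "\<beta> \<in> {\<alpha> \<in> multi_words k n. \<alpha> i \<noteq> [] \<and> h (\<alpha> i) = j}"
    then have ne: "\<alpha> i \<noteq> []" "\<beta> i \<noteq> []" and h: "h (\<alpha> i) = h (\<beta> i)" by auto
    have "t (\<alpha> i) = t (\<beta> i)" using fun_cong[OF eq, of i] by simp
    with ne h have "\<alpha> i = \<beta> i" by (rule inj)
    moreover have "\<alpha> l = \<beta> l" if "l \<noteq> i" for l using fun_cong[OF eq, of l] that by simp
    ultimately show "\<alpha> = \<beta>" by (metis ext)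
  qed
qed (use i t in \<open>auto intro!: multi_words_upd dest: multi_words_nth\<close>)

lemma ampliation_shift_ket:
  assumes \<beta>: "\<beta> \<in> multi_words k n"
    and w: "w \<in> words (n i)" "w \<noteq> []" "h w = j" "t w = \<beta> i"
  shows "ampliation k n i A (ket \<beta>) = ket (\<beta>(i := w))"
proof
  fix \<alpha>
  \<comment> \<open>The only multi-word from which removing the letter \<open>j\<close> in
    coordinate \<open>i\<close> gives \<beta> is \<open>\<beta>(i := w)\<close>, because letter and
    remainder determine a nonempty word.\<close>
  have iff: "\<alpha> \<in> multi_words k n \<and> \<alpha> i \<noteq> [] \<and> h (\<alpha> i) = j \<and> \<alpha>(i := t (\<alpha> i)) = \<beta> \<longleftrightarrow> \<alpha> = \<beta>(i := w)"
  proof safe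
    assume *: "\<alpha> i \<noteq> []" "j = h (\<alpha> i)" "\<beta> = \<alpha>(i := t (\<alpha> i))"
    then have "\<alpha> i = w" using w by (auto intro: inj[of "\<alpha> i" w])
    then show "\<alpha> = (\<alpha>(i := t (\<alpha> i)))(i := w)" by auto
  qed (use w \<beta> i in \<open>auto intro: multi_words_upd\<close>)
  have "ampliation k n i A (ket \<beta>) \<alpha> = (if \<alpha> \<in> multi_words k n \<and> \<alpha> i \<noteq> [] \<and> h (\<alpha> i) = j
      \<and> \<alpha>(i := t (\<alpha> i)) = \<beta> then 1 else 0)"
    unfolding ampliation_shift using ket_in_l2[OF \<beta>] by (simp add: ket_def[of \<beta>])
  then show "ampliation k n i A (ket \<beta>) \<alpha> = ket (\<beta>(i := w)) \<alpha>"
    unfolding iff by (simp add: ket_def)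
qed

end

lemma
  assumes i: "i \<in> {1..k}"
  shows S_op_in_bop: "S_op k n i j \<in> bop (multi_words k n)"
    and S_op_ket: "\<beta> \<in> multi_words k n \<Longrightarrow> j \<in> {1..n i} \<Longrightarrow> S_op k n i j (ket \<beta>) = ket (\<beta>(i := j # \<beta> i))"
proof -
  have tl: "tl \<beta> \<in> words m" if "\<beta> \<in> words m" for \<beta> m
    using that by (cases \<beta>) (auto simp: words_def)
  show "S_op k n i j \<in> bop (multi_words k n)"
    unfolding S_op_def
    by (rule ampliation_shift_in_bop[OF i, where h = hd and t = tl and j = j])
       (auto simp: left_creation_def neq_Nil_conv tl)
  have word: "j # \<beta> i \<in> words (n i)" if "\<beta> \<in> multi_words k n" "j \<in> {1..n i}"
    using multi_words_nth[OF that(1) i] that(2) by (auto simp: words_def)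
  show "S_op k n i j (ket \<beta>) = ket (\<beta>(i := j # \<beta> i))" if "\<beta> \<in> multi_words k n" "j \<in> {1..n i}"
    unfolding S_op_def
    by (rule ampliation_shift_ket[OF i, where h = hd and t = tl and j = j])
       (use that word in \<open>auto simp: left_creation_def neq_Nil_conv tl\<close>)
qed

lemma
  assumes i: "i \<in> {1..k}"
  shows R_op_in_bop: "R_op k n i j \<in> bop (multi_words k n)"
    and R_op_ket: "\<beta> \<in> multi_words k n \<Longrightarrow> j \<in> {1..n i} \<Longrightarrow> R_op k n i j (ket \<beta>) = ket (\<beta>(i := \<beta> i @ [j]))"
proof -
  have inj: "\<alpha> = \<beta>" if "\<alpha> \<noteq> []" "\<beta> \<noteq> []" "last \<alpha> = last \<beta>" "butlast \<alpha> = butlast \<beta>" for \<alpha> \<beta> :: "nat list"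
    using that by (metis append_butlast_last_id)
  have butlast: "butlast \<beta> \<in> words m" if "\<beta> \<in> words m" for \<beta> m
    using that by (auto simp: words_def dest: in_set_butlastD)
  show "R_op k n i j \<in> bop (multi_words k n)"
    unfolding R_op_def
    by (rule ampliation_shift_in_bop[OF i, where h = last and t = butlast and j = j])
       (auto simp: right_creation_def inj butlast)
  have word: "\<beta> i @ [j] \<in> words (n i)" if "\<beta> \<in> multi_words k n" "j \<in> {1..n i}"
    using multi_words_nth[OF that(1) i] that(2) by (auto simp: words_def)
  show "R_op k n i j (ket \<beta>) = ket (\<beta>(i := \<beta> i @ [j]))" if "\<beta> \<in> multi_words k n" "j \<in> {1..n i}"
    unfolding R_op_def
    by (rule ampliation_shift_ket[OF i, where h = last and t = butlast and j = j])
       (use that word in \<open>auto simp: right_creation_def inj butlast\<close>)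
qed

section \<open>Multi-Toeplitz operators in terms of their matrices\<close>

text \<open>Rows indexed outside \<open>I\<close> vanish for both operators, so comparing the
  entries over \<open>I\<close> is enough.\<close>

lemma bop_eq_iff:
  assumes T: "T \<in> bop I" and S: "S \<in> bop I"
  shows "T = S \<longleftrightarrow> (\<forall>\<alpha>\<in>I. \<forall>\<beta>\<in>I. T (ket \<beta>) \<alpha> = S (ket \<beta>) \<alpha>)"
proof
  assume eq: "\<forall>\<alpha>\<in>I. \<forall>\<beta>\<in>I. T (ket \<beta>) \<alpha> = S (ket \<beta>) \<alpha>"
  show "T = S"
  proof (rule bop_eqI[OF T S], rule ext)
    fix \<beta> \<alpha> assume \<beta>: "\<beta> \<in> I"
    show "T (ket \<beta>) \<alpha> = S (ket \<beta>) \<alpha>"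
    proof (cases "\<alpha> \<in> I")
      case False
      then show ?thesis
        using l2_outside[OF bop_in_l2[OF T ket_in_l2[OF \<beta>]]]
          l2_outside[OF bop_in_l2[OF S ket_in_l2[OF \<beta>]]] by simp
    qed (use eq \<beta> in blast)
  qed
qed simp

lemma words_snoc: "w \<in> words m \<Longrightarrow> s \<in> {1..m} \<Longrightarrow> w @ [s] \<in> words m"
  by (auto simp: words_def)

lemma multi_words_snoc:
  "\<alpha> \<in> multi_words k n \<Longrightarrow> i \<in> {1..k} \<Longrightarrow> s \<in> {1..n i} \<Longrightarrow> \<alpha>(i := \<alpha> i @ [s]) \<in> multi_words k n"
  by (intro multi_words_upd words_snoc multi_words_nth)

text \<open>Moving the adjoint to the other side of the inner product makes both right creation
  operators act on basis vectors, where they append a letter. The operator identity thus becomes a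
  recursion on matrix entries.\<close>

lemma multi_Toeplitz_iff:
  "multi_Toeplitz k n T \<longleftrightarrow> T \<in> bop (multi_words k n) \<and>
     (\<forall>i\<in>{1..k}. \<forall>s\<in>{1..n i}. \<forall>t\<in>{1..n i}. \<forall>\<alpha>\<in>multi_words k n. \<forall>\<beta>\<in>multi_words k n.
        T (ket (\<beta>(i := \<beta> i @ [t]))) (\<alpha>(i := \<alpha> i @ [s])) = (if s = t then T (ket \<beta>) \<alpha> else 0))"
proof -
  let ?I = "multi_words k n"
  have "adj_op ?I (R_op k n i s) \<circ> T \<circ> R_op k n i t = (if s = t then T else 0) \<longleftrightarrow>
      (\<forall>\<alpha>\<in>?I. \<forall>\<beta>\<in>?I. T (ket (\<beta>(i := \<beta> i @ [t]))) (\<alpha>(i := \<alpha> i @ [s]))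
        = (if s = t then T (ket \<beta>) \<alpha> else 0))"
    if T: "T \<in> bop ?I" and i: "i \<in> {1..k}" and st: "s \<in> {1..n i}" "t \<in> {1..n i}" for i s t
  proof -
    have R: "R_op k n i s \<in> bop ?I" for s using i by (rule R_op_in_bop)
    have lhs: "adj_op ?I (R_op k n i s) \<circ> T \<circ> R_op k n i t \<in> bop ?I"
      by (intro bop_comp adj_op_in_bop R T)
    have rhs: "(if s = t then T else 0) \<in> bop ?I"
      using T l2_op.subspace_0[OF subspace_bop, of ?I] by (cases "s = t") (simp_all only: if_True if_False simp_thms)
    have "(adj_op ?I (R_op k n i s) \<circ> T \<circ> R_op k n i t) (ket \<beta>) \<alpha>
        = T (ket (\<beta>(i := \<beta> i @ [t]))) (\<alpha>(i := \<alpha> i @ [s]))" if "\<alpha> \<in> ?I" "\<beta> \<in> ?I" for \<alpha> \<beta>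
    proof -
      have "ket (\<beta>(i := \<beta> i @ [t])) \<in> l2 ?I"
        using that i st by (intro ket_in_l2 multi_words_snoc)
      then show ?thesis
        using that i st by (simp add: R_op_ket adj_op_ket[OF R] bop_in_l2[OF T])
    qed
    then show ?thesis
      unfolding bop_eq_iff[OF lhs rhs] by auto
  qed
  then show ?thesis unfolding multi_Toeplitz_def by blast
qed

lemma subspace_multi_Toeplitz: "l2_op.subspace {T. multi_Toeplitz k n T}"
proof (rule l2_op.subspaceI)
  show "0 \<in> {T. multi_Toeplitz k n T}"
    using l2_op.subspace_0[OF subspace_bop] by (auto simp: multi_Toeplitz_iff)
next
  fix S T assume "S \<in> {T. multi_Toeplitz k n T}" "T \<in> {T. multi_Toeplitz k n T}"
  then show "S + T \<in> {T. multi_Toeplitz k n T}"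
    using l2_op.subspace_add[OF subspace_bop] by (auto simp: multi_Toeplitz_iff)
next
  fix c T assume "T \<in> {T. multi_Toeplitz k n T}"
  then show "scale_op c T \<in> {T. multi_Toeplitz k n T}"
    using l2_op.subspace_scale[OF subspace_bop] by (auto simp: multi_Toeplitz_iff scale_op_def)
qed

lemma closedin_wot_multi_Toeplitz: "closedin (wot (multi_words k n)) {T. multi_Toeplitz k n T}"
proof -
  let ?I = "multi_words k n"
  \<comment> \<open>Each relation compares two matrix coefficients with factor 1 or 0 according to
    whether the appended letters agree.\<close>
  define E where "E = (\<lambda>(i, s, t, \<alpha>, \<beta>). (ket (\<beta>(i := \<beta> i @ [t])), ket (\<alpha>(i := \<alpha> i @ [s])),
      ket \<beta>, ket \<alpha>, if s = t then 1 else 0 :: complex)) ` {(i, s, t, \<alpha>, \<beta>).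
      i \<in> {1..k} \<and> s \<in> {1..n i} \<and> t \<in> {1..n i} \<and> \<alpha> \<in> ?I \<and> \<beta> \<in> ?I}"
  have "closedin (wot ?I)
      {T \<in> bop ?I. \<forall>(x, y, x', y', c)\<in>E. l2_inner (T x) y = c * l2_inner (T x') y'}"
    by (rule closedin_bop_equations)
       (auto simp: E_def continuous_map_wot_inner ket_in_l2 multi_words_snoc)
  also have "{T \<in> bop ?I. \<forall>(x, y, x', y', c)\<in>E. l2_inner (T x) y = c * l2_inner (T x') y'}
      = {T. multi_Toeplitz k n T}"
    unfolding multi_Toeplitz_iff E_def ball_simps(9) by (intro Collect_cong) (auto simp: Ball_def)
  finally show ?thesis .
qed

section \<open>The polyball algebra commutes with the right creation operators\<close>

text \<open>The norm closed algebra that is compared with the hull defining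
  \<open>polyball_algebra\<close>.\<close>

definition R_commutant :: "nat \<Rightarrow> (nat \<Rightarrow> nat) \<Rightarrow> (nat \<Rightarrow> nat list) l2_op set" where
  "R_commutant k n = {T \<in> bop (multi_words k n).
     \<forall>i\<in>{1..k}. \<forall>j\<in>{1..n i}. T \<circ> R_op k n i j = R_op k n i j \<circ> T}"

text \<open>The right creation operator standing to the left of \<open>T\<close> is moved across the
  inner product. Commutation then becomes a family of equations between coefficients of
  \<open>T\<close> alone, the form that \<open>closedin_bop_equations\<close> accepts.\<close>

lemma R_commutant_eq:
  "R_commutant k n = {T \<in> bop (multi_words k n).
     \<forall>i\<in>{1..k}. \<forall>j\<in>{1..n i}. \<forall>\<alpha>\<in>multi_words k n. \<forall>\<beta>\<in>multi_words k n.
       l2_inner (T (ket (\<beta>(i := \<beta> i @ [j])))) (ket \<alpha>)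
       = l2_inner (T (ket \<beta>)) (adj_op (multi_words k n) (R_op k n i j) (ket \<alpha>))}"
proof -
  let ?I = "multi_words k n"
  have "T \<circ> R_op k n i j = R_op k n i j \<circ> T \<longleftrightarrow> (\<forall>\<alpha>\<in>?I. \<forall>\<beta>\<in>?I.
      l2_inner (T (ket (\<beta>(i := \<beta> i @ [j])))) (ket \<alpha>)
      = l2_inner (T (ket \<beta>)) (adj_op ?I (R_op k n i j) (ket \<alpha>)))"
    if T: "T \<in> bop ?I" and i: "i \<in> {1..k}" and j: "j \<in> {1..n i}" for T i j
  proof -
    have R: "R_op k n i j \<in> bop ?I" using i by (rule R_op_in_bop)
    show ?thesis
      unfolding bop_eq_iff[OF bop_comp[OF T R] bop_comp[OF R T]]
      by (intro ball_cong refl)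
         (simp add: R_op_ket[where n = n, OF i _ j] adj_op_inner[OF R bop_in_l2[OF T]] ket_in_l2)
  qed
  then show ?thesis unfolding R_commutant_def by blast
qed

lemma norm_closed_algebra_R_commutant: "norm_closed_algebra (multi_words k n) (R_commutant k n)"
  unfolding norm_closed_algebra_def
proof (intro conjI ballI)
  let ?I = "multi_words k n"
  have adj: "adj_op ?I (R_op k n i j) (ket \<alpha>) \<in> l2 ?I" if "i \<in> {1..k}" "\<alpha> \<in> ?I" for i j \<alpha>
    using bop_in_l2[OF adj_op_in_bop[OF R_op_in_bop[OF that(1)]] ket_in_l2[OF that(2)]] .
  have ket: "ket (\<beta>(i := \<beta> i @ [j])) \<in> l2 ?I" if "i \<in> {1..k}" "j \<in> {1..n i}" "\<beta> \<in> ?I" for i j \<beta>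
    using that by (intro ket_in_l2 multi_words_snoc)
  show "R_commutant k n \<subseteq> bop ?I" by (auto simp: R_commutant_def)
  show "l2_op.subspace (R_commutant k n)"
  proof (rule l2_op.subspaceI)
    show "0 \<in> R_commutant k n"
      using l2_op.subspace_0[OF subspace_bop] by (auto simp: R_commutant_eq)
  next
    fix S T assume S: "S \<in> R_commutant k n" and T: "T \<in> R_commutant k n"
    then have bop: "S \<in> bop ?I" "T \<in> bop ?I" by (auto simp: R_commutant_def)
    have "l2_inner ((S + T) x) y = l2_inner (S x) y + l2_inner (T x) y"
      if "x \<in> l2 ?I" "y \<in> l2 ?I" for x y
      using l2_inner_add_left[OF bop_in_l2[OF bop(1) that(1)] bop_in_l2[OF bop(2) that(1)] that(2)]
      by simp
    then show "S + T \<in> R_commutant k n"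
      using S T l2_op.subspace_add[OF subspace_bop bop]
      \<comment> \<open>The rule for inner products with basis vectors is switched off: it would
        rewrite one side of each equation to a plain entry, out of reach of the linearity fact
        above.\<close>
      unfolding R_commutant_eq by (simp add: adj ket ket_in_l2 del: l2_inner_ket_right)
  next
    fix c T assume T: "T \<in> R_commutant k n"
    have "l2_inner (scale_op c T x) y = c * l2_inner (T x) y" for x y
      by (simp add: scale_op_def l2_inner_scale_left)
    then show "scale_op c T \<in> R_commutant k n"
      using T l2_op.subspace_scale[OF subspace_bop, of T ?I c]
      unfolding R_commutant_eq by (simp del: l2_inner_ket_right)
  qed
  show "S \<circ> T \<in> R_commutant k n" if S: "S \<in> R_commutant k n" and T: "T \<in> R_commutant k n" for S T
  proof -
    have "S \<circ> T \<circ> R_op k n i j = R_op k n i j \<circ> (S \<circ> T)" if "i \<in> {1..k}" "j \<in> {1..n i}" for i j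
    proof -
      have SR: "S \<circ> R_op k n i j = R_op k n i j \<circ> S" and TR: "T \<circ> R_op k n i j = R_op k n i j \<circ> T"
        using S T that by (auto simp: R_commutant_def)
      have "S \<circ> T \<circ> R_op k n i j = (S \<circ> R_op k n i j) \<circ> T"
        unfolding comp_assoc TR by (rule refl)
      also have "\<dots> = R_op k n i j \<circ> (S \<circ> T)"
        unfolding SR by (rule comp_assoc)
      finally show ?thesis .
    qed
    then show ?thesis using S T bop_comp[of S ?I T] unfolding R_commutant_def by blast
  qed
  define E where "E = (\<lambda>(i, j, \<alpha>, \<beta>). (ket (\<beta>(i := \<beta> i @ [j])), ket \<alpha>, ket \<beta>,
      adj_op ?I (R_op k n i j) (ket \<alpha>), 1 :: complex)) ` {(i, j, \<alpha>, \<beta>).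
      i \<in> {1..k} \<and> j \<in> {1..n i} \<and> \<alpha> \<in> ?I \<and> \<beta> \<in> ?I}"
  have "closedin (norm_op_topology ?I)
      {T \<in> bop ?I. \<forall>(x, y, x', y', c)\<in>E. l2_inner (T x) y = c * l2_inner (T x') y'}"
    by (rule closedin_bop_equations)
       (auto simp: E_def continuous_map_norm_op_inner ket_in_l2 multi_words_snoc adj)
  also have "{T \<in> bop ?I. \<forall>(x, y, x', y', c)\<in>E. l2_inner (T x) y = c * l2_inner (T x') y'}
      = R_commutant k n"
    unfolding R_commutant_eq E_def ball_simps(9)
    by (intro Collect_cong) (auto simp: Ball_def simp del: l2_inner_ket_right)
  finally show "closedin (norm_op_topology ?I) (R_commutant k n)" .
qed

lemma multi_words_cons:
  "\<alpha> \<in> multi_words k n \<Longrightarrow> i \<in> {1..k} \<Longrightarrow> j \<in> {1..n i} \<Longrightarrow> \<alpha>(i := j # \<alpha> i) \<in> multi_words k n"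
  using multi_words_nth[of \<alpha> k n i] by (intro multi_words_upd) (auto simp: words_def)

text \<open>Prefixing and appending letters commute, also within the same coordinate.\<close>

lemma S_op_in_R_commutant:
  assumes i: "i \<in> {1..k}" and j: "j \<in> {1..n i}"
  shows "S_op k n i j \<in> R_commutant k n"
proof -
  have "S_op k n i j \<circ> R_op k n l t = R_op k n l t \<circ> S_op k n i j" if l: "l \<in> {1..k}" "t \<in> {1..n l}" for l t
  proof (rule bop_eqI)
    fix \<beta> assume \<beta>: "\<beta> \<in> multi_words k n"
    have "(\<beta>(l := \<beta> l @ [t]))(i := j # (\<beta>(l := \<beta> l @ [t])) i)
        = (\<beta>(i := j # \<beta> i))(l := (\<beta>(i := j # \<beta> i)) l @ [t])"
      by (auto simp: fun_eq_iff)
    then show "(S_op k n i j \<circ> R_op k n l t) (ket \<beta>) = (R_op k n l t \<circ> S_op k n i j) (ket \<beta>)"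
      using i j l \<beta> by (simp only: o_apply S_op_ket R_op_ket multi_words_cons multi_words_snoc)
  qed (use i l in \<open>auto intro!: bop_comp S_op_in_bop R_op_in_bop\<close>)
  then show ?thesis using i by (auto simp: R_commutant_def S_op_in_bop)
qed

lemma polyball_algebra_subset_R_commutant: "polyball_algebra k n \<subseteq> R_commutant k n"
  unfolding polyball_algebra_def
proof (rule hull_minimal)
  have "id_op (multi_words k n) \<circ> R_op k n i j = R_op k n i j \<circ> id_op (multi_words k n)"
    if "i \<in> {1..k}" for i j
  proof
    fix x
    show "(id_op (multi_words k n) \<circ> R_op k n i j) x = (R_op k n i j \<circ> id_op (multi_words k n)) x"
      using bop_in_l2[OF R_op_in_bop[OF that], of x] bop_outside[OF R_op_in_bop[OF that], of x]
        bop_zero_arg[OF R_op_in_bop[OF that]]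
      by (cases "x \<in> l2 (multi_words k n)") (auto simp: id_op_def fun_eq_iff zero_fun_def)
  qed
  then have "id_op (multi_words k n) \<in> R_commutant k n"
    unfolding R_commutant_def using id_op_in_bop by blast
  then show "insert (id_op (multi_words k n)) {S_op k n i j |i j. i \<in> {1..k} \<and> j \<in> {1..n i}}
      \<subseteq> R_commutant k n"
    using S_op_in_R_commutant by blast
qed (rule norm_closed_algebra_R_commutant)

text \<open>Multi-words ending in different letters in coordinate \<open>i\<close> are different,
  and appending a fixed letter is injective; so the product of adjoint and shift is the identity or
  0.\<close>

lemma R_op_inner:
  assumes i: "i \<in> {1..k}" and st: "s \<in> {1..n i}" "t \<in> {1..n i}"
    and x: "x \<in> l2 (multi_words k n)" and y: "y \<in> l2 (multi_words k n)"
  shows "l2_inner (R_op k n i t x) (R_op k n i s y) = (if s = t then l2_inner x y else 0)"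
proof -
  let ?I = "multi_words k n"
  have R: "R_op k n i j \<in> bop ?I" for j using i by (rule R_op_in_bop)
  have eq: "adj_op ?I (R_op k n i t) \<circ> R_op k n i s = (if s = t then id_op ?I else 0)"
  proof (subst bop_eq_iff)
    show "\<forall>\<alpha>\<in>?I. \<forall>\<beta>\<in>?I. (adj_op ?I (R_op k n i t) \<circ> R_op k n i s) (ket \<beta>) \<alpha>
        = (if s = t then id_op ?I else 0) (ket \<beta>) \<alpha>"
    proof (intro ballI)
      fix \<alpha> \<beta> assume \<alpha>: "\<alpha> \<in> ?I" and \<beta>: "\<beta> \<in> ?I"
      have "\<alpha>(i := \<alpha> i @ [t]) = \<beta>(i := \<beta> i @ [s]) \<longleftrightarrow> \<alpha> = \<beta> \<and> s = t"
        by (auto simp: fun_eq_iff split: if_splits)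
      then have "ket (\<beta>(i := \<beta> i @ [s])) (\<alpha>(i := \<alpha> i @ [t])) = (if s = t then ket \<beta> \<alpha> else 0)"
        by (auto simp: ket_def)
      then show "(adj_op ?I (R_op k n i t) \<circ> R_op k n i s) (ket \<beta>) \<alpha>
          = (if s = t then id_op ?I else 0) (ket \<beta>) \<alpha>"
        using i st \<alpha> \<beta>
        by (simp add: R_op_ket adj_op_ket[OF R] ket_in_l2 multi_words_snoc id_op_def)
    qed
  qed (auto intro!: bop_comp adj_op_in_bop R id_op_in_bop l2_op.subspace_0[OF subspace_bop])
  have "l2_inner (R_op k n i t x) (R_op k n i s y)
      = l2_inner x ((adj_op ?I (R_op k n i t) \<circ> R_op k n i s) y)"
    by (simp add: adj_op_inner[OF R x bop_in_l2[OF R y]])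
  also have "\<dots> = (if s = t then l2_inner x y else 0)"
    unfolding eq using y by (simp add: id_op_def)
  finally show ?thesis .
qed

text \<open>An entry of the product is the inner product of a column of \<open>g\<close> with a
  column of \<open>f\<close>. Appending letters to the indices applies right creation operators to
  these columns, which \<open>R_op_inner\<close> then cancels or annihilates.\<close>

lemma span_star_product_subset_multi_Toeplitz: "span_star_product k n \<subseteq> {T. multi_Toeplitz k n T}"
  unfolding span_star_product_def
proof (rule l2_op.span_minimal[OF _ subspace_multi_Toeplitz], clarify)
  let ?I = "multi_words k n"
  fix f g assume "f \<in> polyball_algebra k n" "g \<in> polyball_algebra k n"
  then have f: "f \<in> R_commutant k n" and g: "g \<in> R_commutant k n"
    using polyball_algebra_subset_R_commutant by blast+
  then have bop: "f \<in> bop ?I" "g \<in> bop ?I" by (auto simp: R_commutant_def)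
  show "multi_Toeplitz k n (adj_op ?I f \<circ> g)"
    unfolding multi_Toeplitz_iff
  proof (intro conjI ballI)
    show "adj_op ?I f \<circ> g \<in> bop ?I" by (intro bop_comp adj_op_in_bop bop)
    fix i s t \<alpha> \<beta> assume i: "i \<in> {1..k}" and st: "s \<in> {1..n i}" "t \<in> {1..n i}"
      and \<alpha>: "\<alpha> \<in> ?I" and \<beta>: "\<beta> \<in> ?I"
    have comm: "h (ket (\<gamma>(i := \<gamma> i @ [j]))) = R_op k n i j (h (ket \<gamma>))"
      if "h \<in> R_commutant k n" "\<gamma> \<in> ?I" "j \<in> {1..n i}" for h \<gamma> j
    proof -
      have "h \<circ> R_op k n i j = R_op k n i j \<circ> h"
        using that i by (auto simp: R_commutant_def)
      then show ?thesis
        using R_op_ket[OF i that(2,3)] by (metis o_apply)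
    qed
    have entry: "(adj_op ?I f \<circ> g) (ket \<delta>) \<gamma> = l2_inner (g (ket \<delta>)) (f (ket \<gamma>))"
      if "\<gamma> \<in> ?I" "\<delta> \<in> ?I" for \<gamma> \<delta>
      using that by (simp add: adj_op_ket[OF bop(1)] bop_in_l2[OF bop(2)] ket_in_l2)
    have "(adj_op ?I f \<circ> g) (ket (\<beta>(i := \<beta> i @ [t]))) (\<alpha>(i := \<alpha> i @ [s]))
        = l2_inner (g (ket (\<beta>(i := \<beta> i @ [t])))) (f (ket (\<alpha>(i := \<alpha> i @ [s]))))"
      by (intro entry multi_words_snoc i st \<alpha> \<beta>)
    also have "\<dots> = l2_inner (R_op k n i t (g (ket \<beta>))) (R_op k n i s (f (ket \<alpha>)))"
      by (simp only: comm[OF f \<alpha> st(1)] comm[OF g \<beta> st(2)])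
    also have "\<dots> = (if s = t then l2_inner (g (ket \<beta>)) (f (ket \<alpha>)) else 0)"
      by (rule R_op_inner[OF i st bop_in_l2[OF bop(2) ket_in_l2[OF \<beta>]]
            bop_in_l2[OF bop(1) ket_in_l2[OF \<alpha>]]])
    finally show "(adj_op ?I f \<circ> g) (ket (\<beta>(i := \<beta> i @ [t]))) (\<alpha>(i := \<alpha> i @ [s]))
        = (if s = t then (adj_op ?I f \<circ> g) (ket \<beta>) \<alpha> else 0)"
      by (simp only: entry[OF \<alpha> \<beta>])
  qed
qed

section \<open>Word shifts in the polyball algebra\<close>

lemma id_op_in_polyball_algebra: "id_op (multi_words k n) \<in> polyball_algebra k n"
  unfolding polyball_algebra_def by (rule hull_inc) simp

lemma S_op_in_polyball_algebra: "i \<in> {1..k} \<Longrightarrow> j \<in> {1..n i} \<Longrightarrow> S_op k n i j \<in> polyball_algebra k n"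
  unfolding polyball_algebra_def by (rule hull_inc) auto

lemma polyball_algebra_comp:
  "S \<in> polyball_algebra k n \<Longrightarrow> T \<in> polyball_algebra k n \<Longrightarrow> S \<circ> T \<in> polyball_algebra k n"
  unfolding polyball_algebra_def hull_def norm_closed_algebra_def by blast

lemma polyball_algebra_subset_bop: "polyball_algebra k n \<subseteq> bop (multi_words k n)"
  using polyball_algebra_subset_R_commutant by (auto simp: R_commutant_def)

text \<open>The bound \<open>k\<close> also acts as a counter in the induction of
  \<open>multi_word_shift\<close>, where only the first \<open>m\<close> coordinates are prefixed.
  Beyond the bound \<beta> is kept, which preserves the default value of extensional
  functions.\<close>

definition multi_append :: "nat \<Rightarrow> (nat \<Rightarrow> nat list) \<Rightarrow> (nat \<Rightarrow> nat list) \<Rightarrow> nat \<Rightarrow> nat list" where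
  "multi_append k \<gamma> \<beta> = (\<lambda>i. if i \<in> {1..k} then \<gamma> i @ \<beta> i else \<beta> i)"

lemma coordinate_word_shift:
  assumes i: "i \<in> {1..k}" and w: "w \<in> words (n i)"
  shows "\<exists>V\<in>polyball_algebra k n. \<forall>\<beta>\<in>multi_words k n. V (ket \<beta>) = ket (\<beta>(i := w @ \<beta> i))"
  using w
proof (induction w)
  case Nil
  show ?case
    by (rule bexI[OF _ id_op_in_polyball_algebra]) (simp add: id_op_def ket_in_l2)
next
  case (Cons j w)
  then have j: "j \<in> {1..n i}" and w: "w \<in> words (n i)" by (auto simp: words_def)
  then obtain V where V: "V \<in> polyball_algebra k n"
    "\<And>\<beta>. \<beta> \<in> multi_words k n \<Longrightarrow> V (ket \<beta>) = ket (\<beta>(i := w @ \<beta> i))"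
    using Cons.IH by blast
  have upd: "\<beta>(i := w @ \<beta> i) \<in> multi_words k n" if "\<beta> \<in> multi_words k n" for \<beta>
    using multi_words_nth[OF that i] w by (intro multi_words_upd that i) (auto simp: words_def)
  have "(S_op k n i j \<circ> V) (ket \<beta>) = ket (\<beta>(i := (j # w) @ \<beta> i))" if "\<beta> \<in> multi_words k n" for \<beta>
    using V(2)[OF that] S_op_ket[OF i upd[OF that] j] by simp
  then show ?case
    using polyball_algebra_comp[OF S_op_in_polyball_algebra[where n = n, OF i j] V(1)] by blast
qed

text \<open>The operator is the product over the coordinates of the word shifts by the components of
  \<gamma>, composed one coordinate at a time.\<close>

lemma multi_word_shift:
  assumes \<gamma>: "\<gamma> \<in> multi_words k n"
  shows "\<exists>V\<in>polyball_algebra k n. \<forall>\<beta>\<in>multi_words k n. V (ket \<beta>) = ket (multi_append k \<gamma> \<beta>)"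
proof -
  \<comment> \<open>Membership of the prefixed multi-word is carried along because the next
    coordinate shift is known only on basis vectors indexed by
    \<open>multi_words k n\<close>.\<close>
  have "\<exists>V\<in>polyball_algebra k n. \<forall>\<beta>\<in>multi_words k n. V (ket \<beta>) = ket (multi_append m \<gamma> \<beta>)
      \<and> multi_append m \<gamma> \<beta> \<in> multi_words k n" if "m \<le> k" for m
    using that
  proof (induction m)
    case 0
    have "multi_append 0 \<gamma> \<beta> = \<beta>" for \<beta> by (auto simp: multi_append_def)
    then show ?case
      by (intro bexI[OF _ id_op_in_polyball_algebra]) (simp add: id_op_def ket_in_l2)
  next
    case (Suc m)
    then obtain V where V: "V \<in> polyball_algebra k n"
      "\<And>\<beta>. \<beta> \<in> multi_words k n \<Longrightarrow>
        V (ket \<beta>) = ket (multi_append m \<gamma> \<beta>) \<and> multi_append m \<gamma> \<beta> \<in> multi_words k n" by force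
    have i: "Suc m \<in> {1..k}" using Suc.prems by simp
    obtain W where W: "W \<in> polyball_algebra k n"
      "\<And>\<beta>. \<beta> \<in> multi_words k n \<Longrightarrow> W (ket \<beta>) = ket (\<beta>(Suc m := \<gamma> (Suc m) @ \<beta> (Suc m)))"
      using coordinate_word_shift[where n = n, OF i multi_words_nth[OF \<gamma> i]] by blast
    have app: "multi_append (Suc m) \<gamma> \<beta>
        = (multi_append m \<gamma> \<beta>)(Suc m := \<gamma> (Suc m) @ multi_append m \<gamma> \<beta> (Suc m))" for \<beta>
      by (auto simp: multi_append_def fun_eq_iff)
    have "(W \<circ> V) (ket \<beta>) = ket (multi_append (Suc m) \<gamma> \<beta>)
        \<and> multi_append (Suc m) \<gamma> \<beta> \<in> multi_words k n" if \<beta>: "\<beta> \<in> multi_words k n" for \<beta>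
    proof
      show "(W \<circ> V) (ket \<beta>) = ket (multi_append (Suc m) \<gamma> \<beta>)"
        using V(2)[OF \<beta>] W(2)[of "multi_append m \<gamma> \<beta>"] by (simp add: app)
      have "multi_append m \<gamma> \<beta> (Suc m) \<in> words (n (Suc m))"
        using V(2)[OF \<beta>] i by (blast intro: multi_words_nth)
      then show "multi_append (Suc m) \<gamma> \<beta> \<in> multi_words k n"
        unfolding app using V(2)[OF \<beta>] i multi_words_nth[OF \<gamma> i]
        by (intro multi_words_upd) (auto simp: words_def)
    qed
    then show ?case using polyball_algebra_comp[OF W(1) V(1)] by blast
  qed
  from this[of k] show ?thesis by blast
qed

section \<open>Schur multipliers given by window overlaps\<close>

lemma l2_inner_truncation_right:
  assumes "finite G"
  shows "l2_inner z (truncation G y) = (\<Sum>\<alpha>\<in>G. z \<alpha> * cnj (y \<alpha>))"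
proof -
  have "l2_inner z (truncation G y) = (\<Sum>\<^sub>\<infinity>\<alpha>\<in>G. z \<alpha> * cnj (y \<alpha>))"
    unfolding l2_inner_def by (rule infsum_cong_neutral) (auto simp: truncation_def)
  then show ?thesis using assms by simp
qed

text \<open>Double counting: after squaring, each index \<beta> contributes once for every point of
  its window, hence \<open>M\<close> times.\<close>

lemma L2_set_windows:
  assumes F: "finite F" and J: "finite J"
    and W: "\<And>\<beta>. \<beta> \<in> F \<Longrightarrow> W \<beta> \<subseteq> J" "\<And>\<beta>. \<beta> \<in> F \<Longrightarrow> card (W \<beta>) = M"
  shows "L2_set (\<lambda>j. L2_set f {\<beta>\<in>F. j \<in> W \<beta>}) J = sqrt M * L2_set f F"
proof -
  have "(\<Sum>j\<in>J. \<Sum>\<beta>\<in>{\<beta>\<in>F. j \<in> W \<beta>}. (f \<beta>)\<^sup>2) = (\<Sum>j\<in>J. \<Sum>\<beta>\<in>F. if j \<in> W \<beta> then (f \<beta>)\<^sup>2 else 0)"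
    using F by (simp add: sum.inter_filter)
  also have "\<dots> = (\<Sum>\<beta>\<in>F. \<Sum>j\<in>J. if j \<in> W \<beta> then (f \<beta>)\<^sup>2 else 0)"
    by (rule sum.swap)
  also have "\<dots> = (\<Sum>\<beta>\<in>F. real M * (f \<beta>)\<^sup>2)"
  proof (rule sum.cong)
    fix \<beta> assume \<beta>: "\<beta> \<in> F"
    have "(\<Sum>j\<in>J. if j \<in> W \<beta> then (f \<beta>)\<^sup>2 else 0) = (\<Sum>j\<in>W \<beta>. (f \<beta>)\<^sup>2)"
      using W(1)[OF \<beta>] J by (intro sum.mono_neutral_cong_right) auto
    then show "(\<Sum>j\<in>J. if j \<in> W \<beta> then (f \<beta>)\<^sup>2 else 0) = real M * (f \<beta>)\<^sup>2"
      using W(2)[OF \<beta>] by simp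
  qed simp
  finally show ?thesis
    by (simp add: L2_set_def sum_nonneg sum_distrib_left[symmetric] real_sqrt_mult)
qed

text \<open>
  Compressing an operator \<open>T\<close> to the windows \<open>{\<alpha>. j \<in> W \<alpha>}\<close> and summing over all \<open>j\<close> multiplies the
  matrix of \<open>T\<close> entrywise by the numbers \<open>card (W \<alpha> \<inter> W \<beta>)\<close>.  Since each \<open>\<alpha>\<close> lies in \<open>M\<close>
  windows, the Cauchy-Schwarz inequality bounds the result by \<open>M\<close> times the bound of \<open>T\<close>.
\<close>

lemma window_overlap_form_bound:
  fixes W :: "'i \<Rightarrow> 'w set"
  assumes T: "T \<in> bop I" and B: "0 \<le> B" "\<And>x. x \<in> l2 I \<Longrightarrow> l2_norm (T x) \<le> B * l2_norm x"
    and F: "finite F" "F \<subseteq> I" and G: "finite G" "G \<subseteq> I"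
    and W: "\<And>\<alpha>. \<alpha> \<in> I \<Longrightarrow> finite (W \<alpha>)" "\<And>\<alpha>. \<alpha> \<in> I \<Longrightarrow> card (W \<alpha>) = M"
  shows "cmod (\<Sum>\<alpha>\<in>G. \<Sum>\<beta>\<in>F. of_nat (card (W \<alpha> \<inter> W \<beta>)) * (x \<beta> * T (ket \<beta>) \<alpha> * cnj (y \<alpha>)))
    \<le> M * B * L2_set (\<lambda>\<beta>. cmod (x \<beta>)) F * L2_set (\<lambda>\<alpha>. cmod (y \<alpha>)) G"
proof -
  \<comment> \<open>Only points in the windows of the finitely many indices involved can contribute,
    so the sum over \<open>j\<close> is finite.\<close>
  define J where "J = (\<Union>\<alpha>\<in>F \<union> G. W \<alpha>)"
  have J: "finite J" unfolding J_def using F G W by (intro finite_UN_I) auto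
  define FJ where "FJ j = {\<beta>\<in>F. j \<in> W \<beta>}" for j
  define GJ where "GJ j = {\<alpha>\<in>G. j \<in> W \<alpha>}" for j
  have fin: "finite (FJ j)" "FJ j \<subseteq> I" "finite (GJ j)" "GJ j \<subseteq> I" for j
    using F G by (auto simp: FJ_def GJ_def)
  have card_eq: "of_nat (card (W \<alpha> \<inter> W \<beta>)) = (\<Sum>j\<in>J. if j \<in> W \<alpha> \<and> j \<in> W \<beta> then 1 else (0::complex))"
    if "\<alpha> \<in> G" for \<alpha> \<beta>
  proof -
    have "(\<Sum>j\<in>J. if j \<in> W \<alpha> \<and> j \<in> W \<beta> then 1 else (0::complex)) = (\<Sum>j\<in>W \<alpha> \<inter> W \<beta>. 1)"
      using J that by (intro sum.mono_neutral_cong_right) (auto simp: J_def)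
    then show ?thesis by simp
  qed
  have "(\<Sum>\<alpha>\<in>G. \<Sum>\<beta>\<in>F. of_nat (card (W \<alpha> \<inter> W \<beta>)) * (x \<beta> * T (ket \<beta>) \<alpha> * cnj (y \<alpha>)))
      = (\<Sum>\<alpha>\<in>G. \<Sum>\<beta>\<in>F. \<Sum>j\<in>J.
          if j \<in> W \<alpha> \<and> j \<in> W \<beta> then x \<beta> * T (ket \<beta>) \<alpha> * cnj (y \<alpha>) else 0)"
    by (intro sum.cong refl) (auto simp: card_eq sum_distrib_right intro!: sum.cong)
  also have "\<dots> = (\<Sum>j\<in>J. \<Sum>\<alpha>\<in>G. \<Sum>\<beta>\<in>F.
      if j \<in> W \<alpha> \<and> j \<in> W \<beta> then x \<beta> * T (ket \<beta>) \<alpha> * cnj (y \<alpha>) else 0)"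
    by (subst (2) sum.swap, subst sum.swap) (rule refl)
  also have "\<dots> = (\<Sum>j\<in>J. \<Sum>\<alpha>\<in>GJ j. \<Sum>\<beta>\<in>FJ j. x \<beta> * T (ket \<beta>) \<alpha> * cnj (y \<alpha>))"
  proof (rule sum.cong[OF refl])
    fix j
    have "(\<Sum>\<beta>\<in>F. if j \<in> W \<alpha> \<and> j \<in> W \<beta> then x \<beta> * T (ket \<beta>) \<alpha> * cnj (y \<alpha>) else 0)
        = (if j \<in> W \<alpha> then \<Sum>\<beta>\<in>FJ j. x \<beta> * T (ket \<beta>) \<alpha> * cnj (y \<alpha>) else 0)" for \<alpha>
      using F by (simp add: FJ_def sum.inter_filter)
    then show "(\<Sum>\<alpha>\<in>G. \<Sum>\<beta>\<in>F. if j \<in> W \<alpha> \<and> j \<in> W \<beta> then x \<beta> * T (ket \<beta>) \<alpha> * cnj (y \<alpha>) else 0)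
        = (\<Sum>\<alpha>\<in>GJ j. \<Sum>\<beta>\<in>FJ j. x \<beta> * T (ket \<beta>) \<alpha> * cnj (y \<alpha>))"
      using G by (simp add: GJ_def sum.inter_filter)
  qed
  also have "\<dots> = (\<Sum>j\<in>J. l2_inner (T (truncation (FJ j) x)) (truncation (GJ j) y))"
    by (simp add: l2_inner_truncation_right fin bop_truncation[OF T fin(1,2)] sum_distrib_right)
  also have "cmod \<dots> \<le> (\<Sum>j\<in>J. B * (L2_set (\<lambda>\<beta>. cmod (x \<beta>)) (FJ j) * L2_set (\<lambda>\<alpha>. cmod (y \<alpha>)) (GJ j)))"
  proof (rule sum_norm_le)
    fix j
    have "cmod (l2_inner (T (truncation (FJ j) x)) (truncation (GJ j) y))
        \<le> l2_norm (T (truncation (FJ j) x)) * l2_norm (truncation (GJ j) y)"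
      by (intro l2_Cauchy_Schwarz[where I = I] bop_in_l2[OF T] truncation_in_l2 fin)
    also have "\<dots> \<le> (B * l2_norm (truncation (FJ j) x)) * l2_norm (truncation (GJ j) y)"
      by (intro mult_right_mono B truncation_in_l2 fin l2_norm_nonneg)
    finally show "cmod (l2_inner (T (truncation (FJ j) x)) (truncation (GJ j) y))
        \<le> B * (L2_set (\<lambda>\<beta>. cmod (x \<beta>)) (FJ j) * L2_set (\<lambda>\<alpha>. cmod (y \<alpha>)) (GJ j))"
      by (simp add: l2_norm_truncation[where I = I] fin mult.assoc)
  qed
  \<comment> \<open>A second use of Cauchy-Schwarz, now over the points \<open>j\<close>. Each of
    the two factors then contributes \<open>sqrt M\<close> by \<open>L2_set_windows\<close>.\<close>
  also have "\<dots> \<le> B * (L2_set (\<lambda>j. L2_set (\<lambda>\<beta>. cmod (x \<beta>)) (FJ j)) J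
      * L2_set (\<lambda>j. L2_set (\<lambda>\<alpha>. cmod (y \<alpha>)) (GJ j)) J)"
    using L2_set_mult_ineq[of "\<lambda>j. L2_set (\<lambda>\<beta>. cmod (x \<beta>)) (FJ j)"
        "\<lambda>j. L2_set (\<lambda>\<alpha>. cmod (y \<alpha>)) (GJ j)" J] B(1)
    by (simp add: sum_distrib_left[symmetric] mult_left_mono)
  also have "\<dots> = M * B * L2_set (\<lambda>\<beta>. cmod (x \<beta>)) F * L2_set (\<lambda>\<alpha>. cmod (y \<alpha>)) G"
  proof -
    have "L2_set (\<lambda>j. L2_set (\<lambda>\<beta>. cmod (x \<beta>)) (FJ j)) J = sqrt M * L2_set (\<lambda>\<beta>. cmod (x \<beta>)) F"
      unfolding FJ_def using F W by (intro L2_set_windows J) (auto simp: J_def)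
    moreover have "L2_set (\<lambda>j. L2_set (\<lambda>\<alpha>. cmod (y \<alpha>)) (GJ j)) J = sqrt M * L2_set (\<lambda>\<alpha>. cmod (y \<alpha>)) G"
      unfolding GJ_def using G W by (intro L2_set_windows J) (auto simp: J_def)
    ultimately have "B * (L2_set (\<lambda>j. L2_set (\<lambda>\<beta>. cmod (x \<beta>)) (FJ j)) J
        * L2_set (\<lambda>j. L2_set (\<lambda>\<alpha>. cmod (y \<alpha>)) (GJ j)) J)
      = B * (sqrt M * sqrt M) * L2_set (\<lambda>\<beta>. cmod (x \<beta>)) F * L2_set (\<lambda>\<alpha>. cmod (y \<alpha>)) G"
      by (simp only: mult_ac)
    then show ?thesis by (simp add: mult_ac)
  qed
  finally show ?thesis .
qed

text \<open>\<open>Q\<close> is bounded by assumption; the point is that the constant of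
  \<open>T\<close> works for it, whatever the size \<open>M\<close> of the windows. As for the
  adjoint, the form is tested on a finite section of the vector to be estimated, and one factor
  \<open>S\<close> cancels.\<close>

lemma window_multiplier_bound:
  fixes W :: "'i \<Rightarrow> 'w set"
  assumes T: "T \<in> bop I" and B: "0 \<le> B" "\<And>x. x \<in> l2 I \<Longrightarrow> l2_norm (T x) \<le> B * l2_norm x"
    and W: "\<And>\<alpha>. \<alpha> \<in> I \<Longrightarrow> finite (W \<alpha>)" "\<And>\<alpha>. \<alpha> \<in> I \<Longrightarrow> card (W \<alpha>) = M" and M: "0 < M"
    and Q: "Q \<in> bop I"
    and QT: "\<And>\<alpha> \<beta>. \<alpha> \<in> I \<Longrightarrow> \<beta> \<in> I \<Longrightarrow>
      of_nat M * Q (ket \<beta>) \<alpha> = of_nat (card (W \<alpha> \<inter> W \<beta>)) * T (ket \<beta>) \<alpha>"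
    and x: "x \<in> l2 I"
  shows "l2_norm (Q x) \<le> B * l2_norm x"
proof -
  have trunc: "l2_norm (Q (truncation F x)) \<le> B * l2_norm x" if F: "finite F" "F \<subseteq> I" for F
  proof (rule l2_norm_leI[where I = I])
    fix \<alpha> assume "\<alpha> \<notin> I"
    then show "Q (truncation F x) \<alpha> = 0"
      by (rule l2_outside[OF bop_in_l2[OF Q truncation_in_l2[OF F]]])
  next
    fix G0 :: "'i set" assume G0: "finite G0"
    define G where "G = G0 \<inter> I"
    have G: "finite G" "G \<subseteq> I" using G0 by (auto simp: G_def)
    define y where "y = Q (truncation F x)"
    define S where "S = L2_set (\<lambda>\<alpha>. cmod (y \<alpha>)) G"
    have y_out: "y \<alpha> = 0" if "\<alpha> \<notin> I" for \<alpha>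
      unfolding y_def using that by (rule l2_outside[OF bop_in_l2[OF Q truncation_in_l2[OF F]]])
    have S0: "L2_set (\<lambda>\<alpha>. cmod (y \<alpha>)) G0 = S"
      unfolding S_def L2_set_def G_def using G0 y_out
      by (intro arg_cong[where f = sqrt] sum.mono_neutral_right) auto
    have "complex_of_real (M * S\<^sup>2) = of_nat M * (\<Sum>\<alpha>\<in>G. y \<alpha> * cnj (y \<alpha>))"
      by (simp add: S_def L2_set_def sum_nonneg complex_norm_square[symmetric])
    also have "\<dots> = (\<Sum>\<alpha>\<in>G. \<Sum>\<beta>\<in>F. of_nat M * (x \<beta> * Q (ket \<beta>) \<alpha> * cnj (y \<alpha>)))"
    proof -
      have "of_nat M * (y \<alpha> * c) = (\<Sum>\<beta>\<in>F. of_nat M * (x \<beta> * Q (ket \<beta>) \<alpha> * c))" for \<alpha> c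
        unfolding y_def bop_truncation[OF Q F] by (simp add: sum_distrib_left sum_distrib_right)
      then show ?thesis by (simp only: sum_distrib_left)
    qed
    also have "\<dots> = (\<Sum>\<alpha>\<in>G. \<Sum>\<beta>\<in>F.
        of_nat (card (W \<alpha> \<inter> W \<beta>)) * (x \<beta> * T (ket \<beta>) \<alpha> * cnj (y \<alpha>)))"
    proof (intro sum.cong refl)
      fix \<alpha> \<beta> assume "\<alpha> \<in> G" "\<beta> \<in> F"
      then have "of_nat M * Q (ket \<beta>) \<alpha> = of_nat (card (W \<alpha> \<inter> W \<beta>)) * T (ket \<beta>) \<alpha>"
        using F G by (intro QT) auto
      then have "x \<beta> * (of_nat M * Q (ket \<beta>) \<alpha>) * cnj (y \<alpha>)
          = x \<beta> * (of_nat (card (W \<alpha> \<inter> W \<beta>)) * T (ket \<beta>) \<alpha>) * cnj (y \<alpha>)" by simp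
      then show "of_nat M * (x \<beta> * Q (ket \<beta>) \<alpha> * cnj (y \<alpha>))
          = of_nat (card (W \<alpha> \<inter> W \<beta>)) * (x \<beta> * T (ket \<beta>) \<alpha> * cnj (y \<alpha>))"
        by (simp only: mult_ac)
    qed
    finally have "M * S\<^sup>2 = cmod \<dots>"
      by (metis abs_of_nonneg norm_of_real of_nat_0_le_iff zero_le_mult_iff zero_le_power2)
    also have "\<dots> \<le> M * B * L2_set (\<lambda>\<beta>. cmod (x \<beta>)) F * L2_set (\<lambda>\<alpha>. cmod (y \<alpha>)) G"
      by (rule window_overlap_form_bound[OF T B F G W])
    also have "\<dots> \<le> M * B * l2_norm x * S"
      unfolding S_def using B F
      by (intro mult_right_mono mult_left_mono L2_set_le_l2_norm[OF x] L2_set_nonneg) auto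
    finally have *: "S * S \<le> (B * l2_norm x) * S"
      using M by (simp add: power2_eq_square mult.assoc)
    have "S \<le> B * l2_norm x"
    proof (cases "S = 0")
      case False
      then have "0 < S"
        using L2_set_nonneg[of "\<lambda>\<alpha>. cmod (y \<alpha>)" G] unfolding S_def by linarith
      then show ?thesis using * mult_le_cancel_right_pos by blast
    qed (simp add: B)
    then show "L2_set (\<lambda>\<alpha>. cmod (Q (truncation F x) \<alpha>)) G0 \<le> B * l2_norm x"
      using S0 by (simp add: y_def)
  qed
  \<comment> \<open>The constant \<open>A\<close> of \<open>Q\<close> itself serves only to make the
    image of the remainder small; it does not enter the final bound.\<close>
  obtain A where A: "0 \<le> A" "\<And>x. x \<in> l2 I \<Longrightarrow> l2_norm (Q x) \<le> A * l2_norm x"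
    using bop_bound[OF Q] by blast
  show ?thesis
  proof (rule field_le_epsilon)
    fix e :: real assume e: "0 < e"
    have "0 < e / (A + 1)" using e A by simp
    then obtain F where F: "finite F" "F \<subseteq> I" "l2_norm (x - truncation F x) \<le> e / (A + 1)"
      by (rule l2_truncation_approx[OF x])
    have tr: "truncation F x \<in> l2 I" and d: "x - truncation F x \<in> l2 I"
      using F x by (auto intro: l2_diff truncation_in_l2)
    have "l2_norm (Q (x - truncation F x)) \<le> A * l2_norm (x - truncation F x)" by (rule A(2)[OF d])
    also have "\<dots> \<le> (A + 1) * (e / (A + 1))"
      using A F by (intro mult_mono) auto
    also have "\<dots> = e" using A by simp
    finally have 1: "l2_norm (Q (x - truncation F x)) \<le> e" .
    have "Q x = Q (truncation F x) + Q (x - truncation F x)"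
      using bop_add_arg[OF Q tr d] by (metis add_diff_cancel_left' add_diff_eq)
    then have "l2_norm (Q x) \<le> l2_norm (Q (truncation F x)) + l2_norm (Q (x - truncation F x))"
      using l2_norm_triangle[OF bop_in_l2[OF Q tr] bop_in_l2[OF Q d]] by (simp only:)
    also have "\<dots> \<le> B * l2_norm x + e" using trunc[OF F(1,2)] 1 by (rule add_mono)
    finally show "l2_norm (Q x) \<le> B * l2_norm x + e" .
  qed
qed

text \<open>A dominated convergence argument: on a finite set the factors converge, and elsewhere
  \<open>\<bar>\<kappa> N \<alpha> - 1\<bar> \<le> 1\<close> keeps the error below the tail of
  \<open>z\<close>.\<close>

lemma l2_multiplier_tendsto:
  fixes \<kappa> :: "nat \<Rightarrow> 'i \<Rightarrow> real"
  assumes z: "z \<in> l2 I" and \<kappa>: "\<And>N \<alpha>. 0 \<le> \<kappa> N \<alpha>" "\<And>N \<alpha>. \<kappa> N \<alpha> \<le> 1"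
    and lim: "\<And>\<alpha>. \<alpha> \<in> I \<Longrightarrow> (\<lambda>N. \<kappa> N \<alpha>) \<longlonglongrightarrow> 1"
  shows "(\<lambda>N. l2_norm (\<lambda>\<alpha>. of_real (\<kappa> N \<alpha>) * z \<alpha> - z \<alpha>)) \<longlonglongrightarrow> 0"
proof (rule LIMSEQ_I)
  fix e :: real assume e: "0 < e"
  then obtain F where F: "finite F" "F \<subseteq> I" "l2_norm (z - truncation F z) \<le> e / 2"
    by (rule_tac l2_truncation_approx[OF z, of "e / 2"]) auto
  let ?w = "\<lambda>N \<alpha>. of_real (\<kappa> N \<alpha>) * z \<alpha> - z \<alpha>"
  have "(\<lambda>N. L2_set (\<lambda>\<alpha>. cmod (?w N \<alpha>)) F) \<longlonglongrightarrow> L2_set (\<lambda>\<alpha>. cmod (of_real 1 * z \<alpha> - z \<alpha>)) F"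
    unfolding L2_set_def using F lim by (intro tendsto_intros) auto
  then have "(\<lambda>N. L2_set (\<lambda>\<alpha>. cmod (?w N \<alpha>)) F) \<longlonglongrightarrow> 0"
    by (simp add: L2_set_def)
  then obtain N0 where N0: "\<And>N. N0 \<le> N \<Longrightarrow> L2_set (\<lambda>\<alpha>. cmod (?w N \<alpha>)) F < e / 2"
    using e by (force simp: LIMSEQ_iff dest: spec[of _ "e / 2"])
  have d: "z - truncation F z \<in> l2 I" using z F by (intro l2_diff truncation_in_l2)
  have "l2_norm (?w N) < e" if N: "N0 \<le> N" for N
  proof -
    define c where "c = (\<lambda>\<alpha>. complex_of_real (\<kappa> N \<alpha> - 1) * (z - truncation F z) \<alpha>)"
    have bound: "L2_set (\<lambda>\<alpha>. cmod (c \<alpha>)) G \<le> l2_norm (z - truncation F z)" if "finite G" for G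
    proof -
      have "cmod (c \<alpha>) \<le> cmod ((z - truncation F z) \<alpha>)" for \<alpha>
        unfolding c_def norm_mult norm_of_real
        using \<kappa>[of N \<alpha>] by (intro mult_left_le_one_le) auto
      then have "L2_set (\<lambda>\<alpha>. cmod (c \<alpha>)) G \<le> L2_set (\<lambda>\<alpha>. cmod ((z - truncation F z) \<alpha>)) G"
        by (intro L2_set_mono) auto
      also have "\<dots> \<le> l2_norm (z - truncation F z)" by (rule L2_set_le_l2_norm[OF d that])
      finally show ?thesis .
    qed
    have outside: "c \<alpha> = 0" if "\<alpha> \<notin> I" for \<alpha> using l2_outside[OF d that] by (simp add: c_def)
    have c: "c \<in> l2 I" "l2_norm c \<le> l2_norm (z - truncation F z)"
      using l2_memI[OF outside bound] l2_norm_leI[OF outside bound] by auto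
    have tr: "truncation F (?w N) \<in> l2 I" using F by (intro truncation_in_l2)
    have "?w N = truncation F (?w N) + c"
      by (auto simp: fun_eq_iff c_def truncation_def algebra_simps)
    then have "l2_norm (?w N) \<le> l2_norm (truncation F (?w N)) + l2_norm c"
      using l2_norm_triangle[OF tr c(1)] by (simp only:)
    also have "\<dots> < e / 2 + e / 2"
      using N0[OF N] F c(2) by (simp add: l2_norm_truncation[where I = I])
    finally show ?thesis by simp
  qed
  then show "\<exists>N0. \<forall>N\<ge>N0. norm (l2_norm (?w N) - 0) < e" by auto
qed

lemma l2_norm_bop_truncation:
  assumes V: "V \<in> bop I" and F: "finite F" "F \<subseteq> I"
  shows "l2_norm (V (truncation F x)) \<le> (\<Sum>\<beta>\<in>F. cmod (x \<beta>) * l2_norm (V (ket \<beta>)))"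
  using F
proof (induction F)
  case empty
  have "truncation {} x = 0" by (auto simp: truncation_def)
  then have "V (truncation {} x) = 0" using bop_zero_arg[OF V] by metis
  then have "l2_norm (V (truncation {} x)) = 0" by (simp only: l2_norm_zero)
  then show ?case by (simp only: sum.empty order_refl)
next
  case (insert \<beta> F)
  then have tr: "truncation F x \<in> l2 I" and k: "ket \<beta> \<in> l2 I"
    by (auto intro: truncation_in_l2 ket_in_l2)
  have "V (truncation (insert \<beta> F) x) = V (truncation F x) + (\<lambda>\<gamma>. x \<beta> * V (ket \<beta>) \<gamma>)"
    by (simp only: truncation_insert[OF insert.hyps(2)] bop_add_arg[OF V tr l2_scale[OF k]]
        bop_scale_arg[OF V k])
  then have "l2_norm (V (truncation (insert \<beta> F) x))
      \<le> l2_norm (V (truncation F x)) + l2_norm (\<lambda>\<gamma>. x \<beta> * V (ket \<beta>) \<gamma>)"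
    using l2_norm_triangle[OF bop_in_l2[OF V tr] l2_scale[OF bop_in_l2[OF V k]]] by (simp only:)
  then show ?case using insert by (simp add: l2_norm_scale)
qed

text \<open>Uniform boundedness turns convergence on basis vectors into convergence everywhere. This
  is where the norm bound on Fejer means is used.\<close>

lemma bop_strong_limitI:
  assumes Q: "\<And>N. Q N \<in> bop I" and T: "T \<in> bop I"
    and Q_bound: "\<And>N x. x \<in> l2 I \<Longrightarrow> l2_norm (Q N x) \<le> B * l2_norm x"
    and T_bound: "\<And>x. x \<in> l2 I \<Longrightarrow> l2_norm (T x) \<le> B * l2_norm x" and B: "0 \<le> B"
    and ket: "\<And>\<beta>. \<beta> \<in> I \<Longrightarrow> (\<lambda>N. l2_norm (Q N (ket \<beta>) - T (ket \<beta>))) \<longlonglongrightarrow> 0"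
    and x: "x \<in> l2 I"
  shows "(\<lambda>N. l2_norm (Q N x - T x)) \<longlonglongrightarrow> 0"
proof (rule LIMSEQ_I)
  fix e :: real assume e: "0 < e"
  have D: "Q N - T \<in> bop I" for N by (rule l2_op.subspace_diff[OF subspace_bop Q T])
  have D_app: "(Q N - T) x = Q N x - T x" for N x by simp
  have D_bound: "l2_norm ((Q N - T) y) \<le> 2 * B * l2_norm y" if y: "y \<in> l2 I" for N y
  proof -
    have "l2_norm (Q N y - T y) \<le> l2_norm (Q N y - 0) + l2_norm (0 - T y)"
      by (rule l2.triangle) (auto intro: bop_in_l2[OF Q] bop_in_l2[OF T] y)
    also have "\<dots> = l2_norm (Q N y) + l2_norm (T y)"
      by (subst (2) l2_norm_minus_commute) simp
    also have "\<dots> \<le> 2 * B * l2_norm y" using Q_bound[OF y, of N] T_bound[OF y] by simp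
    finally show ?thesis by simp
  qed
  \<comment> \<open>The difference is bounded by \<open>2 * B\<close>; adding 1 keeps the divisor
    positive, and the outer 2 leaves half of \<open>e\<close> for the truncated part.\<close>
  have "0 < e / (2 * (2 * B + 1))" using e B by simp
  then obtain F where F: "finite F" "F \<subseteq> I" "l2_norm (x - truncation F x) \<le> e / (2 * (2 * B + 1))"
    by (rule l2_truncation_approx[OF x])
  have tr: "truncation F x \<in> l2 I" and d: "x - truncation F x \<in> l2 I"
    using F x by (auto intro: l2_diff truncation_in_l2)
  have tr_bound: "l2_norm ((Q N - T) (truncation F x))
      \<le> (\<Sum>\<beta>\<in>F. cmod (x \<beta>) * l2_norm (Q N (ket \<beta>) - T (ket \<beta>)))" for N
    using l2_norm_bop_truncation[OF D F(1,2), of N x] by simp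
  have "(\<lambda>N. \<Sum>\<beta>\<in>F. cmod (x \<beta>) * l2_norm (Q N (ket \<beta>) - T (ket \<beta>))) \<longlonglongrightarrow> (\<Sum>\<beta>\<in>F. cmod (x \<beta>) * 0)"
    using F by (intro tendsto_intros ket) auto
  then obtain N0 where N0: "\<And>N. N0 \<le> N \<Longrightarrow>
      (\<Sum>\<beta>\<in>F. cmod (x \<beta>) * l2_norm (Q N (ket \<beta>) - T (ket \<beta>))) < e / 2"
    using e by (force simp: LIMSEQ_iff sum_nonneg dest: spec[of _ "e / 2"])
  have "l2_norm (Q N x - T x) < e" if N: "N0 \<le> N" for N
  proof -
    have "l2_norm ((Q N - T) (x - truncation F x)) \<le> 2 * B * l2_norm (x - truncation F x)"
      by (rule D_bound[OF d])
    also have "\<dots> \<le> (2 * B + 1) * (e / (2 * (2 * B + 1)))"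
      using B F by (intro mult_mono) auto
    also have "\<dots> = e / 2" using B by (simp add: field_simps)
    finally have 1: "l2_norm ((Q N - T) (x - truncation F x)) \<le> e / 2" .
    have "(Q N - T) x = (Q N - T) (truncation F x) + (Q N - T) (x - truncation F x)"
      using bop_add_arg[OF D tr d, of N] by (metis add_diff_cancel_left' add_diff_eq)
    then have "l2_norm ((Q N - T) x)
        \<le> l2_norm ((Q N - T) (truncation F x)) + l2_norm ((Q N - T) (x - truncation F x))"
      using l2_norm_triangle[OF bop_in_l2[OF D tr] bop_in_l2[OF D d]] by (simp only:)
    also have "\<dots> < e / 2 + e / 2"
      using tr_bound[of N] N0[OF N] 1 by linarith
    finally show ?thesis by simp
  qed
  then show "\<exists>N0. \<forall>N\<ge>N0. norm (l2_norm (Q N x - T x) - 0) < e" by auto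
qed

section \<open>Fejer means of multi-Toeplitz operators\<close>

text \<open>Truncated subtraction makes \<open>strip a b\<close> or \<open>strip b a\<close> empty.
  Whether the shorter word is a suffix of the longer one is a separate condition, expressed by
  \<open>strip a b @ b = strip b a @ a\<close>.\<close>

definition strip :: "nat list \<Rightarrow> nat list \<Rightarrow> nat list" where
  "strip a b = take (length a - length b) a"

lemma length_strip: "length (strip a b) = length a - length b"
  by (simp add: strip_def)

lemma strip_in_words: "a \<in> words m \<Longrightarrow> strip a b \<in> words m"
  by (auto simp: words_def strip_def dest: in_set_takeD)

text \<open>Comparing lengths decides which word is empty, and the other is then a prefix of known
  length. In the Fejer mean this leaves at most one pair of shifts for each matrix entry.\<close>

lemma strip_unique:
  assumes "c = [] \<or> d = []" "c @ b = d @ a"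
  shows "c = strip a b" "d = strip b a"
  using assms by (auto simp: strip_def)

text \<open>Last letters are peeled off both words: unequal ones give 0, equal ones disappear, and
  the process stops when one word is empty, where stripping changes nothing.\<close>

lemma Toeplitz_word_entry:
  fixes p :: "nat list \<Rightarrow> nat list \<Rightarrow> complex"
  assumes p: "\<And>a b s t. a \<in> words m \<Longrightarrow> b \<in> words m \<Longrightarrow> s \<in> {1..m} \<Longrightarrow> t \<in> {1..m} \<Longrightarrow>
      p (a @ [s]) (b @ [t]) = (if s = t then p a b else 0)"
    and ab: "a \<in> words m" "b \<in> words m"
  shows "p a b = (if strip a b @ b = strip b a @ a then p (strip a b) (strip b a) else 0)"
  using ab
proof (induction a arbitrary: b rule: rev_induct)
  case Nil
  show ?case by (simp add: strip_def)
next
  case (snoc s a)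
  show ?case
  proof (cases b rule: rev_cases)
    case Nil
    then show ?thesis by (simp add: strip_def)
  next
    case (snoc b' t)
    then have words: "a \<in> words m" "b' \<in> words m" "s \<in> {1..m}" "t \<in> {1..m}"
      using snoc.prems \<open>b = b' @ [t]\<close> by (auto simp: words_def)
    have strip: "strip (a @ [s]) b = strip a b'" "strip b (a @ [s]) = strip b' a"
      using \<open>b = b' @ [t]\<close> by (auto simp: strip_def)
    have "p (a @ [s]) b = (if s = t then p a b' else 0)"
      using \<open>b = b' @ [t]\<close> p[OF words] by simp
    also have "\<dots> = (if s = t \<and> strip a b' @ b' = strip b' a @ a then p (strip a b') (strip b' a) else 0)"
      using snoc.IH[OF words(1,2)] by simp
    finally show ?thesis
      unfolding strip using \<open>b = b' @ [t]\<close> by auto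
  qed
qed

text \<open>The set \<open>J\<close> allows induction over the coordinates already stripped.\<close>

definition multi_strip :: "nat set \<Rightarrow> (nat \<Rightarrow> nat list) \<Rightarrow> (nat \<Rightarrow> nat list) \<Rightarrow> nat \<Rightarrow> nat list" where
  "multi_strip J \<alpha> \<beta> = (\<lambda>i. if i \<in> J then strip (\<alpha> i) (\<beta> i) else \<alpha> i)"

lemma multi_strip_in_multi_words:
  assumes \<alpha>: "\<alpha> \<in> multi_words k n" and J: "J \<subseteq> {1..k}"
  shows "multi_strip J \<alpha> \<beta> \<in> multi_words k n"
proof -
  have "multi_strip J \<alpha> \<beta> i \<in> words (n i)" if "i \<in> {1..k}" for i
    using multi_words_nth[OF \<alpha> that] by (simp add: multi_strip_def strip_in_words)
  moreover have "multi_strip J \<alpha> \<beta> i = undefined" if "i \<notin> {1..k}" for i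
    using \<alpha> J that by (auto simp: multi_strip_def multi_words_def PiE_def extensional_def)
  ultimately show ?thesis by (auto simp: multi_words_def PiE_def extensional_def)
qed

lemma multi_Toeplitz_entry_strip:
  assumes T: "multi_Toeplitz k n T" and \<alpha>: "\<alpha> \<in> multi_words k n" and \<beta>: "\<beta> \<in> multi_words k n"
    and J: "J \<subseteq> {1..k}"
  shows "T (ket \<beta>) \<alpha> = (if \<forall>i\<in>J. strip (\<alpha> i) (\<beta> i) @ \<beta> i = strip (\<beta> i) (\<alpha> i) @ \<alpha> i
    then T (ket (multi_strip J \<beta> \<alpha>)) (multi_strip J \<alpha> \<beta>) else 0)"
proof -
  have "finite J" using J by (rule finite_subset) simp
  then show ?thesis using J
  proof (induction J)
    case empty
    show ?case by (simp add: multi_strip_def)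
  next
    case (insert i J)
    then have i: "i \<in> {1..k}" and J: "J \<subseteq> {1..k}" and iJ: "i \<notin> J" by auto
    let ?\<alpha> = "multi_strip J \<alpha> \<beta>" and ?\<beta> = "multi_strip J \<beta> \<alpha>"
    \<comment> \<open>With all other coordinates frozen in their current form, the entry is a
      function of the words in coordinate \<open>i\<close> alone and satisfies the one-variable
      Toeplitz recursion.\<close>
    define p where "p a b = T (ket (?\<beta>(i := b))) (?\<alpha>(i := a))" for a b
    have p: "p (a @ [s]) (b @ [t]) = (if s = t then p a b else 0)"
      if ab: "a \<in> words (n i)" "b \<in> words (n i)" and st: "s \<in> {1..n i}" "t \<in> {1..n i}" for a b s t
    proof -
      have "?\<alpha>(i := a) \<in> multi_words k n" "?\<beta>(i := b) \<in> multi_words k n"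
        using \<alpha> \<beta> J i ab by (auto intro!: multi_words_upd multi_strip_in_multi_words)
      then have "T (ket ((?\<beta>(i := b))(i := (?\<beta>(i := b)) i @ [t]))) ((?\<alpha>(i := a))(i := (?\<alpha>(i := a)) i @ [s]))
          = (if s = t then T (ket (?\<beta>(i := b))) (?\<alpha>(i := a)) else 0)"
        using T i st unfolding multi_Toeplitz_iff by blast
      then show ?thesis by (simp add: p_def)
    qed
    have upd: "?\<alpha>(i := \<alpha> i) = ?\<alpha>" "?\<beta>(i := \<beta> i) = ?\<beta>"
      using iJ by (auto simp: multi_strip_def fun_eq_iff)
    have upd': "?\<alpha>(i := strip (\<alpha> i) (\<beta> i)) = multi_strip (insert i J) \<alpha> \<beta>"
      "?\<beta>(i := strip (\<beta> i) (\<alpha> i)) = multi_strip (insert i J) \<beta> \<alpha>"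
      by (auto simp: multi_strip_def fun_eq_iff)
    have "T (ket ?\<beta>) ?\<alpha> = (if strip (\<alpha> i) (\<beta> i) @ \<beta> i = strip (\<beta> i) (\<alpha> i) @ \<alpha> i
        then T (ket (multi_strip (insert i J) \<beta> \<alpha>)) (multi_strip (insert i J) \<alpha> \<beta>) else 0)"
      using Toeplitz_word_entry[of "n i" p, OF p multi_words_nth[OF \<alpha> i] multi_words_nth[OF \<beta> i]]
      unfolding p_def upd upd' by blast
    then show ?case using insert.IH[OF J] by simp
  qed
qed

text \<open>
  The Fejer kernel of order \<open>N\<close>, as a function of the degrees of \<open>\<alpha>\<close> and \<open>\<beta>\<close>: the truncated
  subtractions give \<open>max 0 (N - \<bar>length (\<alpha> i) - length (\<beta> i)\<bar>)\<close>, which is the overlap of the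
  windows of length \<open>N\<close> starting at \<open>length (\<alpha> i)\<close> and \<open>length (\<beta> i)\<close>.
\<close>

definition fejer :: "nat \<Rightarrow> nat \<Rightarrow> (nat \<Rightarrow> nat list) \<Rightarrow> (nat \<Rightarrow> nat list) \<Rightarrow> real" where
  "fejer k N \<alpha> \<beta> = (\<Prod>i=1..k.
     real (N - (length (\<alpha> i) - length (\<beta> i)) - (length (\<beta> i) - length (\<alpha> i))) / real N)"

lemma fejer_bounds: "0 \<le> fejer k N \<alpha> \<beta>" "fejer k N \<alpha> \<beta> \<le> 1"
  unfolding fejer_def by (auto intro!: prod_nonneg prod_le_1 divide_le_eq_1[THEN iffD2])

lemma fejer_tendsto: "(\<lambda>N. fejer k (Suc N) \<alpha> \<beta>) \<longlonglongrightarrow> 1"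
proof -
  have "(\<lambda>N. real (Suc N - p - q) / real (Suc N)) \<longlonglongrightarrow> 1" for p q
  proof -
    have "(\<lambda>N. 1 - (real p + real q) * (1 / real (Suc N))) \<longlonglongrightarrow> 1 - (real p + real q) * 0"
      using LIMSEQ_inverse_real_of_nat by (intro tendsto_intros) (simp add: inverse_eq_divide)
    moreover have "\<forall>\<^sub>F N in sequentially.
        1 - (real p + real q) * (1 / real (Suc N)) = real (Suc N - p - q) / real (Suc N)"
      unfolding eventually_sequentially
    \<comment> \<open>From this index on the natural subtractions are exact.\<close>
    proof (intro exI[of _ "p + q"] allI impI)
      fix N assume "p + q \<le> N"
      then have "real (Suc N - p - q) = real (Suc N) - (real p + real q)" by simp
      then show "1 - (real p + real q) * (1 / real (Suc N)) = real (Suc N - p - q) / real (Suc N)"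
        by (simp add: diff_divide_distrib del: of_nat_Suc)
    qed
    ultimately show ?thesis by (simp add: tendsto_cong)
  qed
  then have "(\<lambda>N. fejer k (Suc N) \<alpha> \<beta>) \<longlonglongrightarrow> (\<Prod>i=1..k. 1)"
    unfolding fejer_def by (intro tendsto_prod)
  then show ?thesis by simp
qed

text \<open>A point \<open>j\<close> lies in the window of \<alpha> iff each length is at most
  \<open>j i\<close> and greater than \<open>j i - N\<close> as integers, so \<open>j\<close>
  selects a box of multidegrees. Starting the window at the length, rather than ending it there,
  leaves it uncut for short words.\<close>

definition window :: "nat \<Rightarrow> nat \<Rightarrow> (nat \<Rightarrow> nat list) \<Rightarrow> (nat \<Rightarrow> nat) set" where
  "window k N \<alpha> = (\<Pi>\<^sub>E i\<in>{1..k}. {length (\<alpha> i)..<length (\<alpha> i) + N})"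

lemma finite_window: "finite (window k N \<alpha>)"
  by (simp add: window_def finite_PiE)

lemma card_window: "card (window k N \<alpha>) = N ^ k"
  by (simp add: window_def card_PiE)

text \<open>The intersection of two boxes is a box. With \<open>M = N ^ k\<close> this says that
  Fejer means satisfy the entry condition of \<open>window_multiplier_bound\<close>.\<close>

lemma card_window_overlap:
  assumes "0 < N"
  shows "real (card (window k N \<alpha> \<inter> window k N \<beta>)) = real (N ^ k) * fejer k N \<alpha> \<beta>"
proof -
  have "window k N \<alpha> \<inter> window k N \<beta> = (\<Pi>\<^sub>E i\<in>{1..k}.
      {max (length (\<alpha> i)) (length (\<beta> i))..<min (length (\<alpha> i) + N) (length (\<beta> i) + N)})"
    by (simp add: window_def PiE_Int)
  then have "card (window k N \<alpha> \<inter> window k N \<beta>) = (\<Prod>i=1..k.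
      N - (length (\<alpha> i) - length (\<beta> i)) - (length (\<beta> i) - length (\<alpha> i)))"
    by (simp add: card_PiE) (intro prod.cong refl, auto simp: min_def max_def)
  then show ?thesis
    using assms by (simp add: fejer_def prod_dividef)
qed

lemma sum_scale_op_apply:
  "finite D \<Longrightarrow> (\<Sum>d\<in>D. scale_op (c d) (U d)) x \<alpha> = (\<Sum>d\<in>D. c d * U d x \<alpha>)"
  by (induction D rule: finite_induct) (auto simp: scale_op_def)

text \<open>The entry at row \<alpha> and column \<beta> of the adjoint of the shift by \<delta>
  times the shift by \<gamma> is 1 if prefixing \<gamma> to \<beta> and \<delta> to \<alpha> gives
  the same multi-word, and 0 otherwise. The mean takes its coefficients from the entries of
  \<open>T\<close> at stripped pairs.\<close>

lemma fejer_mean_in_span: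
  assumes T: "multi_Toeplitz k n T" and N: "0 < N"
  obtains Q where "Q \<in> span_star_product k n"
    "\<And>\<alpha> \<beta>. \<alpha> \<in> multi_words k n \<Longrightarrow> \<beta> \<in> multi_words k n \<Longrightarrow>
      Q (ket \<beta>) \<alpha> = of_real (fejer k N \<alpha> \<beta>) * T (ket \<beta>) \<alpha>"
proof -
  let ?I = "multi_words k n"
  obtain V where V: "\<And>\<gamma>. \<gamma> \<in> ?I \<Longrightarrow> V \<gamma> \<in> polyball_algebra k n"
    "\<And>\<gamma> \<beta>. \<gamma> \<in> ?I \<Longrightarrow> \<beta> \<in> ?I \<Longrightarrow> V \<gamma> (ket \<beta>) = ket (multi_append k \<gamma> \<beta>)"
    using multi_word_shift[of _ k n] by metis
  \<comment> \<open>Words of length \<open>N\<close> or more can be left out, since the kernel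
    vanishes for a stripped pair containing one.\<close>
  define P where "P = {\<gamma> \<in> ?I. \<forall>i\<in>{1..k}. length (\<gamma> i) < N}"
  \<comment> \<open>The condition selects stripped pairs, so that no matrix entry is counted
    twice.\<close>
  define D where "D = {(\<gamma>, \<delta>) \<in> P \<times> P. \<forall>i\<in>{1..k}. \<gamma> i = [] \<or> \<delta> i = []}"
  have "P \<subseteq> (\<Pi>\<^sub>E i\<in>{1..k}. {w. set w \<subseteq> {1..n i} \<and> length w \<le> N})"
    by (auto simp: P_def multi_words_def words_def PiE_def Pi_def less_imp_le)
  then have "finite P"
    by (rule finite_subset) (auto intro!: finite_PiE finite_lists_length_le)
  then have finD: "finite D" by (rule_tac finite_subset[of D "P \<times> P"]) (auto simp: D_def)
  have D_mem: "\<gamma> \<in> ?I" "\<delta> \<in> ?I" if "(\<gamma>, \<delta>) \<in> D" for \<gamma> \<delta>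
    using that by (auto simp: D_def P_def)
  define c where "c = (\<lambda>(\<gamma>, \<delta>). of_real (fejer k N \<gamma> \<delta>) * T (ket \<delta>) \<gamma>)"
  define Q where "Q = (\<Sum>d\<in>D. scale_op (c d) (adj_op ?I (V (snd d)) \<circ> V (fst d)))"
  have "Q \<in> span_star_product k n"
    unfolding Q_def span_star_product_def
    by (intro l2_op.span_sum l2_op.span_scale l2_op.span_base)
       (use V(1) D_mem in force)
  moreover have "Q (ket \<beta>) \<alpha> = of_real (fejer k N \<alpha> \<beta>) * T (ket \<beta>) \<alpha>" if \<alpha>: "\<alpha> \<in> ?I" and \<beta>: "\<beta> \<in> ?I" for \<alpha> \<beta>
  proof -
    let ?\<gamma> = "multi_strip {1..k} \<alpha> \<beta>" and ?\<delta> = "multi_strip {1..k} \<beta> \<alpha>"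
    define comparable where
      "comparable \<longleftrightarrow> (\<forall>i\<in>{1..k}. strip (\<alpha> i) (\<beta> i) @ \<beta> i = strip (\<beta> i) (\<alpha> i) @ \<alpha> i)"
    have entry: "(adj_op ?I (V \<delta>) \<circ> V \<gamma>) (ket \<beta>) \<alpha>
        = (if (\<gamma>, \<delta>) = (?\<gamma>, ?\<delta>) \<and> comparable then 1 else 0)" if d: "(\<gamma>, \<delta>) \<in> D" for \<gamma> \<delta>
    proof -
      have bop: "V \<gamma> \<in> bop ?I" "V \<delta> \<in> bop ?I"
        using V(1) D_mem[OF d] polyball_algebra_subset_bop by blast+
      \<comment> \<open>Off \<open>{1..k}\<close> every multi-word has the default value, so
        equality of these functions is decided by the coordinates in \<open>{1..k}\<close>.\<close>
      have outside: "\<alpha> i = \<beta> i" "\<gamma> i = ?\<gamma> i" "\<delta> i = ?\<delta> i" if "i \<notin> {1..k}" for i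
        using that \<alpha> \<beta> D_mem[OF d]
        by (auto simp: multi_strip_def multi_words_def PiE_def extensional_def)
      have "multi_append k \<gamma> \<beta> = multi_append k \<delta> \<alpha> \<longleftrightarrow> (\<forall>i\<in>{1..k}. \<gamma> i @ \<beta> i = \<delta> i @ \<alpha> i)"
        using outside by (auto simp: multi_append_def fun_eq_iff)
      also have "\<dots> \<longleftrightarrow> (\<forall>i\<in>{1..k}. \<gamma> i = strip (\<alpha> i) (\<beta> i) \<and> \<delta> i = strip (\<beta> i) (\<alpha> i)) \<and> comparable"
      proof -
        have "\<gamma> i @ \<beta> i = \<delta> i @ \<alpha> i \<longleftrightarrow> (\<gamma> i = strip (\<alpha> i) (\<beta> i) \<and> \<delta> i = strip (\<beta> i) (\<alpha> i))
            \<and> strip (\<alpha> i) (\<beta> i) @ \<beta> i = strip (\<beta> i) (\<alpha> i) @ \<alpha> i" if "i \<in> {1..k}" for i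
        proof -
          have "\<gamma> i = [] \<or> \<delta> i = []" using d that by (auto simp: D_def)
          then show ?thesis
            using strip_unique[of "\<gamma> i" "\<delta> i" "\<beta> i" "\<alpha> i"] by argo
        qed
        then show ?thesis unfolding comparable_def by blast
      qed
      also have "\<dots> \<longleftrightarrow> (\<gamma>, \<delta>) = (?\<gamma>, ?\<delta>) \<and> comparable"
      proof -
        have "\<gamma> = ?\<gamma> \<longleftrightarrow> (\<forall>i\<in>{1..k}. \<gamma> i = ?\<gamma> i)" "\<delta> = ?\<delta> \<longleftrightarrow> (\<forall>i\<in>{1..k}. \<delta> i = ?\<delta> i)"
          using outside(2,3) unfolding fun_eq_iff by blast+
        then show ?thesis by (simp add: multi_strip_def ball_conj_distrib)
      qed
      finally have iff: "multi_append k \<gamma> \<beta> = multi_append k \<delta> \<alpha>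
          \<longleftrightarrow> (\<gamma>, \<delta>) = (?\<gamma>, ?\<delta>) \<and> comparable" .
      have "(adj_op ?I (V \<delta>) \<circ> V \<gamma>) (ket \<beta>) \<alpha> = l2_inner (V \<gamma> (ket \<beta>)) (V \<delta> (ket \<alpha>))"
        by (simp add: adj_op_ket[OF bop(2) \<alpha> bop_in_l2[OF bop(1) ket_in_l2[OF \<beta>]]])
      also have "\<dots> = ket (multi_append k \<gamma> \<beta>) (multi_append k \<delta> \<alpha>)"
        using V(2) D_mem[OF d] \<alpha> \<beta> by simp
      also have "\<dots> = (if multi_append k \<gamma> \<beta> = multi_append k \<delta> \<alpha> then 1 else 0)"
        by (auto simp: ket_def)
      finally show ?thesis unfolding iff .
    qed
    have "Q (ket \<beta>) \<alpha> = (\<Sum>d\<in>D. c d * (adj_op ?I (V (snd d)) \<circ> V (fst d)) (ket \<beta>) \<alpha>)"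
      unfolding Q_def by (rule sum_scale_op_apply[OF finD])
    also have "\<dots> = (\<Sum>d\<in>D. if d = (?\<gamma>, ?\<delta>) then (if comparable then c d else 0) else 0)"
    proof (rule sum.cong[OF refl])
      fix d assume "d \<in> D"
      then show "c d * (adj_op ?I (V (snd d)) \<circ> V (fst d)) (ket \<beta>) \<alpha>
          = (if d = (?\<gamma>, ?\<delta>) then (if comparable then c d else 0) else 0)"
        using entry[of "fst d" "snd d"] by (cases d) simp
    qed
    also have "\<dots> = (if (?\<gamma>, ?\<delta>) \<in> D \<and> comparable then c (?\<gamma>, ?\<delta>) else 0)"
      using finD by simp
    also have "\<dots> = of_real (fejer k N \<alpha> \<beta>) * T (ket \<beta>) \<alpha>"
    proof -
      have T_entry: "T (ket \<beta>) \<alpha> = (if comparable then T (ket ?\<delta>) ?\<gamma> else 0)"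
        unfolding comparable_def by (rule multi_Toeplitz_entry_strip[OF T \<alpha> \<beta> order_refl])
      \<comment> \<open>Stripping preserves both truncated length differences, which are all that
        the kernel depends on.\<close>
      have fejer_eq: "fejer k N ?\<gamma> ?\<delta> = fejer k N \<alpha> \<beta>"
        unfolding fejer_def by (intro prod.cong refl) (auto simp: multi_strip_def length_strip)
      \<comment> \<open>A stripped pair can fail to lie in \<open>D\<close> only by containing a
        word of length at least \<open>N\<close>, and then the corresponding factor of the kernel is
        0.\<close>
      have "fejer k N \<alpha> \<beta> = 0" if "(?\<gamma>, ?\<delta>) \<notin> D"
      proof -
        have mem: "?\<gamma> \<in> ?I" "?\<delta> \<in> ?I"
          using \<alpha> \<beta> by (auto intro: multi_strip_in_multi_words)
        have "?\<gamma> i = [] \<or> ?\<delta> i = []" if "i \<in> {1..k}" for i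
          using that by (auto simp: multi_strip_def strip_def)
        then have "\<not> (\<forall>i\<in>{1..k}. length (?\<gamma> i) < N \<and> length (?\<delta> i) < N)"
          using that mem unfolding D_def P_def by blast
        then obtain i where i: "i \<in> {1..k}" and "N \<le> length (?\<gamma> i) \<or> N \<le> length (?\<delta> i)"
          by (meson not_less)
        then have "N - (length (\<alpha> i) - length (\<beta> i)) - (length (\<beta> i) - length (\<alpha> i)) = 0"
          by (auto simp: multi_strip_def length_strip)
        then show ?thesis
          unfolding fejer_def using i by (intro prod_zero) auto
      qed
      then show ?thesis unfolding c_def prod.case fejer_eq T_entry by auto
    qed
    finally show ?thesis .
  qed
  ultimately show ?thesis by (rule that)
qed

text \<open>The means are taken of order \<open>Suc N\<close>, which keeps the divisor positive;
  they form the sequence required by \<open>sot_closure_sequentialI\<close>.\<close>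

lemma multi_Toeplitz_subset_sot_closure:
  "{T. multi_Toeplitz k n T} \<subseteq> sot (multi_words k n) closure_of span_star_product k n"
proof clarify
  let ?I = "multi_words k n"
  fix T assume MT: "multi_Toeplitz k n T"
  then have T: "T \<in> bop ?I" by (simp add: multi_Toeplitz_def)
  obtain B where B: "0 \<le> B" "\<And>x. x \<in> l2 ?I \<Longrightarrow> l2_norm (T x) \<le> B * l2_norm x"
    using bop_bound[OF T] by blast
  have "\<exists>Q\<in>span_star_product k n. \<forall>\<alpha>\<in>?I. \<forall>\<beta>\<in>?I.
      Q (ket \<beta>) \<alpha> = of_real (fejer k (Suc N) \<alpha> \<beta>) * T (ket \<beta>) \<alpha>" for N
    using fejer_mean_in_span[OF MT, of "Suc N"] by (metis zero_less_Suc)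
  then obtain Q where Q: "\<And>N. Q N \<in> span_star_product k n"
    and entry: "\<And>N \<alpha> \<beta>. \<alpha> \<in> ?I \<Longrightarrow> \<beta> \<in> ?I \<Longrightarrow>
      Q N (ket \<beta>) \<alpha> = of_real (fejer k (Suc N) \<alpha> \<beta>) * T (ket \<beta>) \<alpha>"
    by metis
  have Q_bop: "Q N \<in> bop ?I" for N
    using Q[of N] span_star_product_subset_multi_Toeplitz[of k n] by (auto simp: multi_Toeplitz_def)
  have Q_bound: "l2_norm (Q N x) \<le> B * l2_norm x" if x: "x \<in> l2 ?I" for N x
  \<comment> \<open>Here \<open>M\<close> is \<open>Suc N ^ k\<close>, and the resulting constant
    \<open>B\<close> is independent of \<open>N\<close>.\<close>
  proof (rule window_multiplier_bound[OF T B _ _ _ Q_bop _ x])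
    fix \<alpha> \<beta> assume \<alpha>\<beta>: "\<alpha> \<in> ?I" "\<beta> \<in> ?I"
    have "complex_of_real (real (card (window k (Suc N) \<alpha> \<inter> window k (Suc N) \<beta>)))
        = of_real (real (Suc N ^ k) * fejer k (Suc N) \<alpha> \<beta>)"
      by (subst card_window_overlap) simp_all
    then have "of_nat (card (window k (Suc N) \<alpha> \<inter> window k (Suc N) \<beta>))
        = of_nat (Suc N ^ k) * complex_of_real (fejer k (Suc N) \<alpha> \<beta>)" by simp
    then show "of_nat (Suc N ^ k) * Q N (ket \<beta>) \<alpha>
        = of_nat (card (window k (Suc N) \<alpha> \<inter> window k (Suc N) \<beta>)) * T (ket \<beta>) \<alpha>"
      by (simp only: entry[OF \<alpha>\<beta>] mult.assoc)
  qed (auto simp: finite_window card_window)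
  have ket: "(\<lambda>N. l2_norm (Q N (ket \<beta>) - T (ket \<beta>))) \<longlonglongrightarrow> 0" if \<beta>: "\<beta> \<in> ?I" for \<beta>
  proof -
    have eq: "Q N (ket \<beta>) - T (ket \<beta>)
        = (\<lambda>\<alpha>. of_real (fejer k (Suc N) \<alpha> \<beta>) * T (ket \<beta>) \<alpha> - T (ket \<beta>) \<alpha>)" for N
    proof
      fix \<alpha>
      show "(Q N (ket \<beta>) - T (ket \<beta>)) \<alpha>
          = of_real (fejer k (Suc N) \<alpha> \<beta>) * T (ket \<beta>) \<alpha> - T (ket \<beta>) \<alpha>"
        using entry[OF _ \<beta>, of \<alpha> N] l2_outside[OF bop_in_l2[OF Q_bop ket_in_l2[OF \<beta>]], of \<alpha> N]
          l2_outside[OF bop_in_l2[OF T ket_in_l2[OF \<beta>]], of \<alpha>]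
        by (cases "\<alpha> \<in> ?I") auto
    qed
    \<comment> \<open>The column of the mean at \<beta> is that of \<open>T\<close> multiplied by
      kernel values in \<open>[0, 1]\<close> that tend to 1 at each row.\<close>
    show ?thesis
      unfolding eq
      by (rule l2_multiplier_tendsto[OF bop_in_l2[OF T ket_in_l2[OF \<beta>]] fejer_bounds fejer_tendsto])
  qed
  show "T \<in> sot ?I closure_of span_star_product k n"
    by (rule sot_closure_sequentialI[OF T Q_bop Q bop_strong_limitI[OF Q_bop T Q_bound B(2) B(1) ket]])
qed

theorem corollary1p8:
  fixes k :: nat and n :: "nat \<Rightarrow> nat"
  assumes "1 \<le> k" and "\<forall>i\<in>{1..k}. 1 \<le> n i"
  shows "{T. multi_Toeplitz k n T} = sot (multi_words k n) closure_of span_star_product k n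
       \<and> sot (multi_words k n) closure_of span_star_product k n
         = wot (multi_words k n) closure_of span_star_product k n"
proof -
  have "wot (multi_words k n) closure_of span_star_product k n \<subseteq> {T. multi_Toeplitz k n T}"
    by (rule closure_of_minimal[OF span_star_product_subset_multi_Toeplitz
          closedin_wot_multi_Toeplitz])
  \<comment> \<open>The inclusions form a cycle: multi-Toeplitz operators, strong closure, weak
    closure, and back. Hence all three sets agree.\<close>
  then show ?thesis
    using multi_Toeplitz_subset_sot_closure[of k n]
      sot_closure_subset_wot_closure[of "multi_words k n" "span_star_product k n"] by blast
qed

end
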